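(* Let $\{\Phi^{(n)}\}_{n \geq 1}$ be a sequence of finite crystallographic root systems and, for each $n$, let $\Psi^{(n)}$ be an antichain in the root poset of $\Phi^{(n)}$, such that $|\Psi^{(n)}| \to \infty$. Then the sequence of random variables $\mathcal{X}_{\Psi^{(n)}}$ is asymptotically normal, i.e. \[ \frac{\mathcal{X}_{\Psi^{(n)}}-\mathbb{E}[\mathcal{X}_{\Psi^{(n)}}]}{\operatorname{Var}(\mathcal{X}_{\Psi^{(n)}})^{1/2}} \longrightarrow \mathcal{N}(0,1) \text{ in distribution.} \] Moreover, the rate of convergence in distribution is bounded by $|\Psi^{(n)}|^{-1/2}$: there is a constant $C$ with $\sup_{x\in\mathbb{R}}\big|\mathbb{P}\big(\tfrac{\mathcal{X}_{\Psi^{(n)}}-\mathbb{E}[\mathcal{X}_{\Psi^{(n)}}]}{\operatorname{Var}(\mathcal{X}_{\Psi^{(n)}})^{1/2}}\le x\big)-\mathbb{P}(\mathcal{N}(0,1)\le x)\big| \le C\,|\Psi^{(n)}|^{-1/2}$ for all sufficiently large $n$.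
   Context: A finite crystallographic root system $\Phi \subset V$ (a Euclidean space with inner product $\langle\cdot,\cdot\rangle$) comes with a choice of simple roots $\Delta$ and positive roots $\Phi^+$, $\Phi = \Phi^+ \cup (-\Phi^+)$; every positive root is a nonnegative integer combination of simple roots. The root poset is the partial order on $\Phi^+$ generated by the cover relations $\beta \prec \gamma$ whenever $\gamma-\beta \in \Delta$. An antichain is a set of pairwise incomparable positive roots. $W$ denotes the Weyl group of $\Phi$ (generated by the reflections $s_\alpha$, $\alpha\in\Delta$). For $\beta\in\Phi^+$, $\mathcal{X}_\beta$ is the Bernoulli random variable on $W$ (with the uniform distribution) given by $\mathcal{X}_\beta(w)=1$ if $w(\beta)\in -\Phi^+$ and $\mathcal{X}_\beta(w)=0$ if $w(\beta)\in\Phi^+$. For $\Psi\subseteq\Phi^+$, $\mathcal{X}_\Psi=\sum_{\beta\in\Psi}\mathcal{X}_\beta$. *)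

theory Defs
  imports "HOL-Probability.Probability"
begin

text \<open>Euclidean d-space is modelled as the functions nat => real vanishing at indices >= d,
  with the standard inner product.  Every finite-dimensional Euclidean space is isometric to one of these.\<close>

definition evec :: "nat \<Rightarrow> (nat \<Rightarrow> real) set" where
  "evec d = {v. \<forall>i\<ge>d. v i = 0}"

definition ip :: "nat \<Rightarrow> (nat \<Rightarrow> real) \<Rightarrow> (nat \<Rightarrow> real) \<Rightarrow> real" where
  "ip d u v = (\<Sum>i<d. u i * v i)"

definition reflect_root :: "nat \<Rightarrow> (nat \<Rightarrow> real) \<Rightarrow> (nat \<Rightarrow> real) \<Rightarrow> (nat \<Rightarrow> real)" where
  "reflect_root d a v = (\<lambda>i. v i - (2 * ip d v a / ip d a a) * a i)"

definition neg_vec :: "(nat \<Rightarrow> real) \<Rightarrow> (nat \<Rightarrow> real)" where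
  "neg_vec v = (\<lambda>i. - v i)"

definition crystallographic_root_system :: "nat \<Rightarrow> (nat \<Rightarrow> real) set \<Rightarrow> bool" where
  "crystallographic_root_system d \<Phi> \<longleftrightarrow>
     finite \<Phi> \<and> \<Phi> \<subseteq> evec d \<and> (\<lambda>i. 0) \<notin> \<Phi> \<and>
     (\<forall>a\<in>\<Phi>. \<forall>c::real. (\<lambda>i. c * a i) \<in> \<Phi> \<longrightarrow> c = 1 \<or> c = -1) \<and>
     (\<forall>a\<in>\<Phi>. reflect_root d a ` \<Phi> = \<Phi>) \<and>
     (\<forall>a\<in>\<Phi>. \<forall>b\<in>\<Phi>. 2 * ip d b a / ip d a a \<in> \<int>)"

definition lin_comb :: "(nat \<Rightarrow> real) set \<Rightarrow> ((nat \<Rightarrow> real) \<Rightarrow> real) \<Rightarrow> (nat \<Rightarrow> real)" where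
  "lin_comb \<Delta> c = (\<lambda>i. \<Sum>a\<in>\<Delta>. c a * a i)"

definition simple_system :: "nat \<Rightarrow> (nat \<Rightarrow> real) set \<Rightarrow> (nat \<Rightarrow> real) set \<Rightarrow> bool" where
  "simple_system d \<Phi> \<Delta> \<longleftrightarrow>
     \<Delta> \<subseteq> \<Phi> \<and>
     (\<forall>c. lin_comb \<Delta> c = (\<lambda>i. 0) \<longrightarrow> (\<forall>a\<in>\<Delta>. c a = 0)) \<and>
     (\<forall>b\<in>\<Phi>. \<exists>k::(nat \<Rightarrow> real) \<Rightarrow> nat.
         b = lin_comb \<Delta> (\<lambda>a. real (k a)) \<or> b = lin_comb \<Delta> (\<lambda>a. - real (k a)))"

definition positive_roots :: "(nat \<Rightarrow> real) set \<Rightarrow> (nat \<Rightarrow> real) set \<Rightarrow> (nat \<Rightarrow> real) set" where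
  "positive_roots \<Phi> \<Delta> = {b\<in>\<Phi>. \<exists>k::(nat \<Rightarrow> real) \<Rightarrow> nat. b = lin_comb \<Delta> (\<lambda>a. real (k a))}"

definition root_cover :: "(nat \<Rightarrow> real) set \<Rightarrow> (nat \<Rightarrow> real) set \<Rightarrow> (nat \<Rightarrow> real) \<Rightarrow> (nat \<Rightarrow> real) \<Rightarrow> bool" where
  "root_cover \<Phi> \<Delta> b g \<longleftrightarrow> b \<in> positive_roots \<Phi> \<Delta> \<and> g \<in> positive_roots \<Phi> \<Delta> \<and>
      (\<lambda>i. g i - b i) \<in> \<Delta>"

definition root_le :: "(nat \<Rightarrow> real) set \<Rightarrow> (nat \<Rightarrow> real) set \<Rightarrow> (nat \<Rightarrow> real) \<Rightarrow> (nat \<Rightarrow> real) \<Rightarrow> bool" where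
  "root_le \<Phi> \<Delta> = (root_cover \<Phi> \<Delta>)\<^sup>*\<^sup>*"

definition root_antichain :: "(nat \<Rightarrow> real) set \<Rightarrow> (nat \<Rightarrow> real) set \<Rightarrow> (nat \<Rightarrow> real) set \<Rightarrow> bool" where
  "root_antichain \<Phi> \<Delta> \<Psi> \<longleftrightarrow> \<Psi> \<subseteq> positive_roots \<Phi> \<Delta> \<and>
     (\<forall>b\<in>\<Psi>. \<forall>g\<in>\<Psi>. b \<noteq> g \<longrightarrow> \<not> root_le \<Phi> \<Delta> b g)"

text \<open>Weyl group: generated by the simple reflections (W is finite, so the generated
  monoid is the generated group).\<close>
inductive_set weyl_group :: "nat \<Rightarrow> (nat \<Rightarrow> real) set \<Rightarrow> ((nat \<Rightarrow> real) \<Rightarrow> (nat \<Rightarrow> real)) set"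
  for d :: nat and \<Delta> :: "(nat \<Rightarrow> real) set" where
  id_in: "id \<in> weyl_group d \<Delta>"
| refl_comp: "w \<in> weyl_group d \<Delta> \<Longrightarrow> a \<in> \<Delta> \<Longrightarrow> reflect_root d a \<circ> w \<in> weyl_group d \<Delta>"

definition X_var :: "(nat \<Rightarrow> real) set \<Rightarrow> (nat \<Rightarrow> real) set \<Rightarrow> (nat \<Rightarrow> real) set
    \<Rightarrow> ((nat \<Rightarrow> real) \<Rightarrow> (nat \<Rightarrow> real)) \<Rightarrow> real" where
  "X_var \<Phi> \<Delta> \<Psi> w = real (card {b\<in>\<Psi>. w b \<in> neg_vec ` positive_roots \<Phi> \<Delta>})"

end

theory Submission
  imports Defs
begin

text \<open>If \<open>a\<close> and \<open>b\<close> are distinct elements of an antichain \<open>\<Psi>\<close>, then \<open>a - b\<close> is not a root. Therefore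
  \<open>\<Psi>\<close> is obtuse, and every root that is an integer combination of \<open>\<Psi>\<close> has coefficients of
  one sign: in a combination \<open>p - q\<close> of mixed signs one can subtract elements of \<open>\<Psi>\<close> from \<open>p\<close> and
  from \<open>q\<close> and stay among the roots, until a difference \<open>a - b\<close> is left. So every subset \<open>A\<close> of \<open>\<Psi>\<close>
  behaves like a simple system of the reflection group \<open>W\<^sub>A\<close>, and on each coset \<open>w W\<^sub>A\<close> the sign
  pattern of \<open>A\<close> has the same distribution. Since \<open>W\<^sub>A\<close> fixes the roots orthogonal to \<open>A\<close>, the sign
  patterns of mutually orthogonal subsets of \<open>\<Psi>\<close> are independent.

  The summands thus have a dependency graph, joining non-orthogonal roots. Positive
  semidefiniteness of the Gram matrix of the normalized roots bounds its degrees by 4. The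
  covariance of two summands is at least \<open>1/(2m) - 1/4\<close> with \<open>2m\<close> the order of the dihedral group,
  which is at least \<open>1/5\<close> of the inner product of the normalized roots; so positive
  semidefiniteness also yields a variance of at least \<open>\<bar>\<Psi>\<bar>/20\<close>. Stein's method for locally
  dependent bounded summands then gives the rate \<open>1/sqrt \<bar>\<Psi>\<bar>\<close>.\<close>

section \<open>The normal distribution and the Stein equation\<close>

text \<open>Root systems are classified only for pairs of roots, and the final constant depends on
  the degree bound and the variance bound alone; this makes it uniform in type and rank. Negativity
  of a root is read off as the sign of its inner product with \<open>rho\<close>, a linear
  functional, and the coset argument works for every functional that vanishes on no root. A subset
  of an antichain need not generate the whole root system, so signs with respect to it are attached
  only to roots in its integer span.

  The obstacle in the probabilistic half is that the indicator of a half-line is not smooth: the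
  Stein solution has a kink at z, and its linearization over a step h fails when the sum lies within
  |h| of z. For the rate to survive, the probability of that event must itself be of the order of a
  single summand. Hence a separate concentration inequality, obtained from the same Stein identity
  with an arctan whose derivative is concentrated near z.\<close>

abbreviation ncdf :: "real \<Rightarrow> real" where
  "ncdf z \<equiv> measure std_normal_distribution {..z}"

lemma prob_space_std_normal: "prob_space std_normal_distribution"
  by (rule prob_space_normal_density) simp

lemma ncdf_bounds: "0 \<le> ncdf z" "ncdf z \<le> 1"
  using prob_space.prob_le_1[OF prob_space_std_normal] by auto

lemma ncdf_diff:
  assumes "a \<le> z"
  shows "ncdf z = ncdf a + integral {a..z} std_normal_density"
proof -
  interpret prob_space std_normal_distribution by (rule prob_space_std_normal)
  have int: "set_integrable lborel {a..z} std_normal_density"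
    unfolding set_integrable_def
    by (rule integrable_mult_indicator) (auto simp: integrable_normal_moment)
  have "{..z} = {..a} \<union> {a<..z}" using assms by auto
  then have "ncdf z = ncdf a + measure std_normal_distribution {a<..z}"
    by (simp add: finite_measure_Union[symmetric] disjoint_iff)
  also have "measure std_normal_distribution {a<..z} = measure std_normal_distribution {a..z}"
  proof (rule measure_eq_AE)
    have "AE x in lborel. x \<noteq> a" by (rule AE_lborel_singleton)
    then show "AE x in std_normal_distribution. (x \<in> {a<..z}) = (x \<in> {a..z})"
      by (auto simp: AE_density elim!: eventually_mono)
  qed auto
  also have "measure std_normal_distribution {a..z} = (LINT x:{a..z}|lborel. std_normal_density x)"
  proof -
    have "emeasure std_normal_distribution {a..z} = (\<integral>\<^sup>+x. ennreal (indicator {a..z} x * std_normal_density x) \<partial>lborel)"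
      by (subst emeasure_density) (auto intro!: nn_integral_cong simp: indicator_def)
    also have "\<dots> = ennreal (LINT x|lborel. indicator {a..z} x * std_normal_density x)"
      using int unfolding set_integrable_def
      by (intro nn_integral_eq_integral) auto
    finally show ?thesis
      unfolding measure_def set_lebesgue_integral_def
      by (simp add: integral_nonneg_AE)
  qed
  also have "\<dots> = integral {a..z} std_normal_density"
    using int by (rule set_borel_integral_eq_integral)
  finally show ?thesis .
qed

lemma ncdf_mono: "a \<le> z \<Longrightarrow> ncdf a \<le> ncdf z"
  using finite_measure.finite_measure_mono[OF prob_space.finite_measure[OF prob_space_std_normal]]
  by auto

lemma DERIV_ncdf: "(ncdf has_real_derivative std_normal_density z) (at z)"
proof -
  have c: "continuous_on {z-1..z+1} std_normal_density"
    unfolding std_normal_density_def by (intro continuous_intros) auto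
  have "((\<lambda>x. integral {z-1..x} std_normal_density) has_real_derivative std_normal_density z)
    (at z within {z-1..z+1})"
    by (rule integral_has_real_derivative[OF c]) auto
  then have "((\<lambda>x. ncdf (z-1) + integral {z-1..x} std_normal_density) has_real_derivative std_normal_density z)
    (at z within {z-1..z+1})"
    by (auto intro!: derivative_eq_intros)
  then have "(ncdf has_real_derivative std_normal_density z) (at z within {z-1..z+1})"
    by (rule has_field_derivative_transform_within[where d=1]) (auto simp: ncdf_diff)
  moreover have "at z within {z-1..z+1} = at z"
    by (rule at_within_interior) auto
  ultimately show ?thesis by simp
qed

lemma DERIV_std_normal_density:
  "(std_normal_density has_real_derivative (- z * std_normal_density z)) (at z)"
proof -
  define c where "c = 1 / sqrt (2 * pi)"
  have "((\<lambda>x. c * exp (- x\<^sup>2 / 2)) has_real_derivative - z * (c * exp (- z\<^sup>2 / 2))) (at z)"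
    by (auto intro!: derivative_eq_intros)
  then show ?thesis unfolding std_normal_density_def c_def .
qed

lemma std_normal_density_pos: "0 < std_normal_density z"
  by (simp add: normal_density_pos)

lemma std_normal_density_minus: "std_normal_density (-z) = std_normal_density z"
  by (simp add: std_normal_density_def)

lemma ncdf_minus: "ncdf (-z) = 1 - ncdf z"
proof -
  interpret prob_space std_normal_distribution by (rule prob_space_std_normal)
  have "emeasure std_normal_distribution {..-z} = (\<integral>\<^sup>+x. ennreal (std_normal_density x) * indicator {..-z} x \<partial>lborel)"
    by (subst emeasure_density) auto
  also have "\<dots> = (\<integral>\<^sup>+x. ennreal (std_normal_density (-x)) * indicator {..-z} (-x) \<partial>lborel)"
    using nn_integral_real_affine[of "\<lambda>x. ennreal (std_normal_density x) * indicator {..-z} x" "-1" 0]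
    by simp
  also have "\<dots> = (\<integral>\<^sup>+x. ennreal (std_normal_density x) * indicator {z..} x \<partial>lborel)"
    by (intro nn_integral_cong) (auto simp: std_normal_density_minus indicator_def)
  also have "\<dots> = emeasure std_normal_distribution {z..}"
    by (subst emeasure_density) auto
  finally have "ncdf (-z) = measure std_normal_distribution {z..}"
    by (simp add: measure_def)
  also have "\<dots> = measure std_normal_distribution {z<..}"
  proof (rule measure_eq_AE)
    have "AE x in lborel. x \<noteq> z" by (rule AE_lborel_singleton)
    then show "AE x in std_normal_distribution. (x \<in> {z..}) = (x \<in> {z<..})"
      by (auto simp: AE_density elim!: eventually_mono)
  qed auto
  also have "\<dots> = 1 - ncdf z"
  proof -
    have "UNIV - {..z} = {z<..}" by auto
    then show ?thesis using prob_compl[of "{..z}"] by (simp add: space_density)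
  qed
  finally show ?thesis .
qed

text \<open>Chebyshev with second moment 1. Quadratic decay is enough to make w * ncdf w vanish at
  minus infinity, as \<open>ncdf_Mills\<close> requires.\<close>

lemma ncdf_le_inverse_square:
  assumes "w < 0" shows "ncdf w \<le> 1 / w\<^sup>2"
proof -
  interpret prob_space std_normal_distribution by (rule prob_space_std_normal)
  have i: "integrable std_normal_distribution (\<lambda>x. x^2)"
    by (rule integrable_std_normal_distribution_moment)
  have m: "(LINT x|std_normal_distribution. x^2) = 1"
    using std_normal_distribution_even_moments(1)[of 1] by (simp add: fact_2)
  have "{..w} \<subseteq> {x \<in> space std_normal_distribution. w\<^sup>2 \<le> x\<^sup>2}"
    using assms by (auto simp: abs_le_square_iff[symmetric])
  then have "ncdf w \<le> measure std_normal_distribution {x \<in> space std_normal_distribution. w\<^sup>2 \<le> x\<^sup>2}"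
    by (intro finite_measure_mono) auto
  also have "\<dots> \<le> (LINT x|std_normal_distribution. x^2) / w\<^sup>2"
    using assms by (intro integral_Markov_inequality_measure[where A="space std_normal_distribution"] i) auto
  finally show ?thesis using m by simp
qed

text \<open>The expression has derivative \<open>ncdf\<close> and is nondecreasing, so a negative
  value would bound it away from 0 all the way to the left, whereas it exceeds 1/x at negative
  x.\<close>

lemma ncdf_Mills: "0 \<le> std_normal_density w + w * ncdf w"
proof (rule ccontr)
  define m where "m = (\<lambda>w. std_normal_density w + w * ncdf w)"
  assume "\<not> ?thesis"
  then have neg: "m w < 0" by (simp add: m_def)
  \<comment> \<open>So far to the left that 1/x is at least half of \<open>m w\<close>; then
    \<open>m x\<close> exceeds \<open>m w\<close>, against monotonicity.\<close>
  define x where "x = min (min w (-1)) (2 / m w)"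
  have x: "x < 0" "x \<le> w" "x \<le> 2 / m w" by (auto simp: x_def)
  have "(m has_real_derivative ncdf y) (at y)" for y
    unfolding m_def
    by (auto intro!: derivative_eq_intros DERIV_std_normal_density DERIV_ncdf)
  then have "m x \<le> m w"
    using ncdf_bounds by (intro DERIV_nonneg_imp_nondecreasing[OF x(2)] exI conjI)
  moreover have "1 / x \<le> x * ncdf x"
  proof -
    have "x * (1 / x\<^sup>2) \<le> x * ncdf x"
      using x(1) ncdf_le_inverse_square[of x] by (intro mult_left_mono_neg) auto
    then show ?thesis using x(1) by (simp add: power2_eq_square)
  qed
  moreover have "m w / 2 \<le> 1 / x"
    using x neg by (simp add: field_simps)
  moreover have "x * ncdf x < m x"
    using std_normal_density_pos[of x] by (simp add: m_def)
  ultimately show False using neg by linarith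
qed

section \<open>The Mills ratio\<close>

definition mills :: "real \<Rightarrow> real" where
  "mills w = ncdf w / std_normal_density w"

lemma mills_nonneg: "0 \<le> mills w"
  by (simp add: mills_def ncdf_bounds)

text \<open>Constant multiples of this solution of g' - w g = 1 solve the Stein equation for w \<le>
  z, where its right-hand side is constant; the reflected ratio serves on the other side.\<close>

lemma DERIV_mills: "(mills has_real_derivative (1 + w * mills w)) (at w)"
proof -
  have "std_normal_density w \<noteq> 0" using std_normal_density_pos[of w] by simp
  then show ?thesis unfolding mills_def
    by (auto intro!: derivative_eq_intros DERIV_std_normal_density DERIV_ncdf simp: field_simps)
qed

lemma mills_deriv_nonneg: "0 \<le> 1 + w * mills w"
  using ncdf_Mills[of w] std_normal_density_pos[of w] by (simp add: mills_def field_simps)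

text \<open>The ratio is nondecreasing, and symmetry gives ncdf 0 = 1/2, so its value at 0 is sqrt
  (2 pi) / 2.\<close>

lemma mills_le_2: assumes "w \<le> 0" shows "mills w \<le> 2"
proof -
  have "mills w \<le> mills 0"
    by (rule DERIV_nonneg_imp_nondecreasing[OF assms]) (rule exI conjI DERIV_mills mills_deriv_nonneg)+
  also have "mills 0 = sqrt (2 * pi) / 2"
    using ncdf_minus[of 0] by (simp add: mills_def std_normal_density_def)
  also have "\<dots> \<le> 2"
    using pi_less_4 by (simp add: real_le_lsqrt)
  finally show ?thesis .
qed

text \<open>At w = z the two sides are the two branches of \<open>stein_sol\<close>, so this is
  their continuity.\<close>

lemma mills_minus: "mills w * (1 - ncdf w) = mills (-w) * ncdf w"
  by (simp add: mills_def ncdf_minus std_normal_density_minus)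

text \<open>For w > 0 the ratio itself is unbounded; there 1 - ncdf z \<le> 1 - ncdf w and
  \<open>mills_minus\<close> trade \<open>mills w\<close> for \<open>mills (-w)\<close>. The second
  expression is the derivative of the left branch.\<close>

lemma stein_left_bounds:
  assumes "w \<le> z"
  shows "\<bar>mills w * (1 - ncdf z)\<bar> \<le> 2" and "\<bar>w * (mills w * (1 - ncdf z)) + (1 - ncdf z)\<bar> \<le> 2"
proof -
  have z: "0 \<le> 1 - ncdf z" "1 - ncdf z \<le> 1 - ncdf w" "1 - ncdf z \<le> 1"
    using ncdf_bounds ncdf_mono[OF assms] by auto
  have a: "mills w * (1 - ncdf z) \<le> mills w * (1 - ncdf w)"
    using mills_nonneg z by (intro mult_left_mono) auto
  have b: "mills (-w) * ncdf w \<le> mills (-w)"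
    using mills_nonneg ncdf_bounds by (intro mult_left_le) auto
  have c: "mills w * (1 - ncdf z) \<le> mills w"
    using mills_nonneg z by (intro mult_left_le) auto
  have nn: "0 \<le> mills w * (1 - ncdf z)" using mills_nonneg z by simp
  have ab: "mills w * (1 - ncdf z) \<le> mills (-w)" using a b mills_minus by simp
  show "\<bar>mills w * (1 - ncdf z)\<bar> \<le> 2"
    using nn ab c mills_le_2[of w] mills_le_2[of "-w"] by (cases "w \<le> 0") auto
  have eq: "w * (mills w * (1 - ncdf z)) + (1 - ncdf z) = (1 + w * mills w) * (1 - ncdf z)"
    by (simp add: algebra_simps)
  have lo: "0 \<le> (1 + w * mills w) * (1 - ncdf z)" using mills_deriv_nonneg z by simp
  show "\<bar>w * (mills w * (1 - ncdf z)) + (1 - ncdf z)\<bar> \<le> 2"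
  proof (cases "w \<le> 0")
    case True
    then have "w * (mills w * (1 - ncdf z)) \<le> 0" using nn by (simp add: mult_le_0_iff)
    then show ?thesis using lo[folded eq] z by linarith
  next
    case False
    then have "w * (mills w * (1 - ncdf z)) \<le> w * mills (-w)" using ab by simp
    also have "\<dots> \<le> 1" using mills_deriv_nonneg[of "-w"] by simp
    finally show ?thesis using lo[folded eq] z by linarith
  qed
qed

text \<open>The bounded solution of f' - w f = of_bool (w \<le> z) - ncdf z.\<close>

definition stein_sol :: "real \<Rightarrow> real \<Rightarrow> real" where
  "stein_sol z w = (if w \<le> z then mills w * (1 - ncdf z) else mills (-w) * ncdf z)"

text \<open>At the kink \<open>w = z\<close> this is the left derivative of the solution.\<close>
definition stein_der :: "real \<Rightarrow> real \<Rightarrow> real" where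
  "stein_der z w = w * stein_sol z w + of_bool (w \<le> z) - ncdf z"

lemma stein_right_bounds:
  assumes "z \<le> w"
  shows "\<bar>mills (-w) * ncdf z\<bar> \<le> 2" and "\<bar>w * (mills (-w) * ncdf z) - ncdf z\<bar> \<le> 2"
  using stein_left_bounds[of "-w" "-z"] assms by (auto simp: ncdf_minus)

lemma stein_der_bound: "\<bar>stein_der z w\<bar> \<le> 2"
  using stein_left_bounds(2)[of w z] stein_right_bounds(2)[of z w]
  by (auto simp: stein_sol_def stein_der_def algebra_simps)

section \<open>Linearization of the Stein solution\<close>

lemma MVT_between:
  fixes g g' :: "real \<Rightarrow> real"
  assumes "\<And>x. (g has_real_derivative g' x) (at x)"
  obtains t where "min u w \<le> t" "t \<le> max u w" "g w - g u = (w - u) * g' t"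
proof (cases u w rule: linorder_cases)
  case less
  obtain t where "u < t" "t < w" "g w - g u = (w - u) * g' t"
    using MVT2[of u w g g'] less assms by blast
  then show ?thesis by (intro that[of t]) auto
next
  case greater
  obtain t where "w < t" "t < u" "g u - g w = (u - w) * g' t"
    using MVT2[of w u g g'] greater assms by blast
  then show ?thesis by (intro that[of t]) (auto simp: algebra_simps)
qed (auto intro: that[of u])

text \<open>The equation itself supplies the second-order control: between w and t the derivative x
  g + c changes by w (g t - g w) + (t - w) g t, and g is Lipschitz. \<open>S\<close> is the
  half-line on which the bounds of a branch hold.\<close>

lemma stein_smooth_remainder:
  fixes g :: "real \<Rightarrow> real"
  assumes der: "\<And>x. (g has_real_derivative (x * g x + c)) (at x)"
    and S: "is_interval S" "u \<in> S" "w \<in> S"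
    and b0: "\<And>x. x \<in> S \<Longrightarrow> \<bar>g x\<bar> \<le> 2" and b1: "\<And>x. x \<in> S \<Longrightarrow> \<bar>x * g x + c\<bar> \<le> 2"
  shows "\<bar>g w - g u\<bar> \<le> 2 * \<bar>w - u\<bar>"
    and "\<bar>g w - g u - (w - u) * (w * g w + c)\<bar> \<le> \<bar>w - u\<bar> * ((2 * \<bar>w\<bar> + 2) * \<bar>w - u\<bar>)"
proof -
  have inS: "t \<in> S" if "min x y \<le> t" "t \<le> max x y" "x \<in> S" "y \<in> S" for t x y
    using S(1) that unfolding is_interval_1 min_def max_def by (metis linorder_linear)
  have lip: "\<bar>g y - g x\<bar> \<le> 2 * \<bar>y - x\<bar>" if xy: "x \<in> S" "y \<in> S" for x y
  proof -
    obtain t where t: "min x y \<le> t" "t \<le> max x y" "g y - g x = (y - x) * (t * g t + c)"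
      using MVT_between[OF der, of x y] by blast
    then show ?thesis using mult_left_mono[OF b1[of t], of "\<bar>y - x\<bar>"] inS[OF t(1,2) xy]
      by (simp add: abs_mult)
  qed
  show "\<bar>g w - g u\<bar> \<le> 2 * \<bar>w - u\<bar>" using lip S by blast
  obtain t where t: "min u w \<le> t" "t \<le> max u w" "g w - g u = (w - u) * (t * g t + c)"
    using MVT_between[OF der, of u w] by blast
  then have tS: "t \<in> S" using inS S by blast
  have tw: "\<bar>t - w\<bar> \<le> \<bar>w - u\<bar>" using t(1,2) by (auto simp: min_def max_def split: if_splits)
  have "t * g t - w * g w = w * (g t - g w) + (t - w) * g t" by (simp add: algebra_simps)
  then have "\<bar>t * g t - w * g w\<bar> \<le> \<bar>w\<bar> * \<bar>g t - g w\<bar> + \<bar>t - w\<bar> * \<bar>g t\<bar>"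
    by (metis abs_mult abs_triangle_ineq)
  also have "\<dots> \<le> \<bar>w\<bar> * (2 * \<bar>w - u\<bar>) + \<bar>w - u\<bar> * 2"
    using lip[OF S(3) tS] tw b0[OF tS] by (intro add_mono mult_mono) auto
  finally have "\<bar>t * g t - w * g w\<bar> \<le> (2 * \<bar>w\<bar> + 2) * \<bar>w - u\<bar>" by (simp add: algebra_simps)
  then have "\<bar>w - u\<bar> * \<bar>t * g t - w * g w\<bar> \<le> \<bar>w - u\<bar> * ((2 * \<bar>w\<bar> + 2) * \<bar>w - u\<bar>)"
    by (intro mult_left_mono) auto
  moreover have "g w - g u - (w - u) * (w * g w + c) = (w - u) * (t * g t - w * g w)"
    unfolding t(3) by (simp add: algebra_simps)
  ultimately show "\<bar>g w - g u - (w - u) * (w * g w + c)\<bar> \<le> \<bar>w - u\<bar> * ((2 * \<bar>w\<bar> + 2) * \<bar>w - u\<bar>)"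
    by (simp only: abs_mult)
qed

text \<open>On one side of the kink a single branch is linearized. If z separates w from w - h, then
  |w - z| \<le> |h|, and the indicator pays for the crude bound 4 |h|: two for the increment and two
  for the linear term.\<close>

lemma stein_remainder:
  "\<bar>stein_sol z w - stein_sol z (w - h) - h * stein_der z w\<bar>
    \<le> \<bar>h\<bar> * ((2 * \<bar>w\<bar> + 2) * \<bar>h\<bar> + 4 * of_bool (\<bar>w - z\<bar> \<le> \<bar>h\<bar>))"
proof -
  define L where "L = (\<lambda>x. mills x * (1 - ncdf z))"
  define R where "R = (\<lambda>x. mills (-x) * ncdf z)"
  define u where "u = w - h"
  have dL: "(L has_real_derivative (x * L x + (1 - ncdf z))) (at x)" for x
    unfolding L_def by (auto intro!: derivative_eq_intros DERIV_mills simp: algebra_simps)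
  have dR: "(R has_real_derivative (x * R x + (- ncdf z))) (at x)" for x
    unfolding R_def
    by (rule derivative_eq_intros DERIV_chain2[OF DERIV_mills] refl)+ (simp add: algebra_simps)
  have bL: "\<bar>L x\<bar> \<le> 2" "\<bar>x * L x + (1 - ncdf z)\<bar> \<le> 2" if "x \<in> {..z}" for x
    using stein_left_bounds[of x z] that by (auto simp: L_def)
  have bR: "\<bar>R x\<bar> \<le> 2" "\<bar>x * R x + (- ncdf z)\<bar> \<le> 2" if "x \<in> {z..}" for x
    using stein_right_bounds[of z x] that by (auto simp: R_def)
  note sL = stein_smooth_remainder[OF dL _ _ _ bL, of "{..z}" , simplified]
  note sR = stein_smooth_remainder[OF dR _ _ _ bR, of "{z..}", simplified]
  have LR: "L z = R z" by (simp add: L_def R_def mills_minus)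
  have fL: "stein_sol z x = L x" if "x \<le> z" for x using that by (simp add: stein_sol_def L_def)
  have fR: "stein_sol z x = R x" if "z \<le> x" for x
    using that LR by (cases "x = z") (auto simp: stein_sol_def R_def L_def)
  have cross: ?thesis if d: "\<bar>stein_sol z w - stein_sol z u\<bar> \<le> 2 * \<bar>h\<bar>" and "\<bar>w - z\<bar> \<le> \<bar>h\<bar>"
  proof -
    have "\<bar>h * stein_der z w\<bar> \<le> \<bar>h\<bar> * 2"
      using stein_der_bound by (simp add: abs_mult mult_left_mono)
    then have "\<bar>stein_sol z w - stein_sol z u - h * stein_der z w\<bar> \<le> \<bar>h\<bar> * 4" using d by linarith
    also have "\<dots> \<le> \<bar>h\<bar> * ((2 * \<bar>w\<bar> + 2) * \<bar>h\<bar> + 4)" by (intro mult_left_mono) auto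
    finally show ?thesis using that by (simp add: u_def)
  qed
  have smooth: ?thesis if "\<bar>stein_sol z w - stein_sol z u - h * stein_der z w\<bar> \<le> \<bar>h\<bar> * ((2 * \<bar>w\<bar> + 2) * \<bar>h\<bar>)"
  proof -
    have "\<bar>h\<bar> * ((2 * \<bar>w\<bar> + 2) * \<bar>h\<bar>) \<le> \<bar>h\<bar> * ((2 * \<bar>w\<bar> + 2) * \<bar>h\<bar> + 4 * of_bool (\<bar>w - z\<bar> \<le> \<bar>h\<bar>))"
      by (intro mult_left_mono) auto
    then show ?thesis using that by (simp add: u_def)
  qed
  \<comment> \<open>The first case contains w = z, where \<open>stein_der\<close> follows the left
    branch.\<close>
  consider "w \<le> z" "u \<le> z" | "z < w" "z \<le> u" | "w \<le> z" "z < u" | "z < w" "u < z" by linarith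
  then show ?thesis
  proof cases
    case 1
    have "stein_der z w = w * L w + (1 - ncdf z)" using 1 by (simp add: stein_der_def fL)
    then show ?thesis using sL(2)[OF 1(2,1)] fL[OF 1(1)] fL[OF 1(2)]
      by (intro smooth) (simp add: u_def)
  next
    case 2
    have "stein_der z w = w * R w + - ncdf z" using 2 by (simp add: stein_der_def fR)
    then show ?thesis using sR(2)[of u w] fR[of w] fR[of u] 2
      by (intro smooth) (simp add: u_def)
  next
    case 3
    have "\<bar>L w - L z\<bar> \<le> 2 * \<bar>w - z\<bar>" "\<bar>R z - R u\<bar> \<le> 2 * \<bar>z - u\<bar>"
      using sL(1)[of z w] sR(1)[of u z] 3 by auto
    then show ?thesis using 3 LR by (intro cross) (auto simp: fL fR u_def)
  next
    case 4
    have "\<bar>R w - R z\<bar> \<le> 2 * \<bar>w - z\<bar>" "\<bar>L z - L u\<bar> \<le> 2 * \<bar>z - u\<bar>"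
      using sR(1)[of z w] sL(1)[of u z] 4 by auto
    then show ?thesis using 4 LR by (intro cross) (auto simp: fL fR u_def)
  qed
qed

section \<open>A Berry--Esseen bound for locally dependent summands\<close>

definition avg :: "'w set \<Rightarrow> ('w \<Rightarrow> real) \<Rightarrow> real" where
  "avg G f = (\<Sum>w\<in>G. f w) / real (card G)"

lemma avg_add: "avg G (\<lambda>w. f w + g w) = avg G f + avg G g"
  by (simp add: avg_def sum.distrib add_divide_distrib)

lemma avg_diff: "avg G (\<lambda>w. f w - g w) = avg G f - avg G g"
  by (simp add: avg_def sum_subtractf diff_divide_distrib)

lemma avg_cmult: "avg G (\<lambda>w. c * f w) = c * avg G f"
  by (simp add: avg_def sum_distrib_left)

lemma avg_sum: "avg G (\<lambda>w. \<Sum>i\<in>I. f i w) = (\<Sum>i\<in>I. avg G (f i))"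
  by (simp add: avg_def sum.swap[of _ I] sum_divide_distrib)

lemma avg_cong: "(\<And>w. w \<in> G \<Longrightarrow> f w = g w) \<Longrightarrow> avg G f = avg G g"
  by (simp add: avg_def)

lemma avg_mono: "(\<And>w. w \<in> G \<Longrightarrow> f w \<le> g w) \<Longrightarrow> avg G f \<le> avg G g"
  by (simp add: avg_def divide_right_mono sum_mono)

lemma avg_const: "finite G \<Longrightarrow> G \<noteq> {} \<Longrightarrow> avg G (\<lambda>w. c) = c"
  by (simp add: avg_def)

lemma abs_avg_le: "\<bar>avg G f\<bar> \<le> avg G (\<lambda>w. \<bar>f w\<bar>)"
  by (simp add: avg_def divide_right_mono)

lemma avg_square_le:
  assumes "finite G" "G \<noteq> {}"
  shows "(avg G f)\<^sup>2 \<le> avg G (\<lambda>w. (f w)\<^sup>2)"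
proof -
  define m where "m = avg G f"
  have "0 \<le> avg G (\<lambda>w. (f w - m)\<^sup>2)" by (simp add: avg_def sum_nonneg)
  also have "avg G (\<lambda>w. (f w - m)\<^sup>2) = avg G (\<lambda>w. (f w)\<^sup>2 - 2 * m * f w + m\<^sup>2)"
    by (intro avg_cong) (simp add: power2_eq_square algebra_simps)
  also have "\<dots> = avg G (\<lambda>w. (f w)\<^sup>2) - m\<^sup>2"
    using assms by (simp add: avg_add avg_diff avg_cmult avg_const flip: m_def) (simp add: power2_eq_square)
  finally show ?thesis by (simp add: m_def)
qed

lemma avg_abs_le_sqrt:
  assumes "finite G" "G \<noteq> {}"
  shows "avg G (\<lambda>w. \<bar>f w\<bar>) \<le> sqrt (avg G (\<lambda>w. (f w)\<^sup>2))"
  using avg_square_le[OF assms, of "\<lambda>w. \<bar>f w\<bar>"] by (simp add: real_le_rsqrt)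

text \<open>The error carries the factor 1 / (1 + y^2), the derivative at y itself, and so can be
  absorbed into the linear term in \<open>concentration\<close>; a plain bound by t^2 could
  not.\<close>

lemma arctan_remainder:
  fixes y t :: real
  assumes "\<bar>t\<bar> \<le> 1"
  shows "\<bar>arctan y - arctan (y - t) - t / (1 + y\<^sup>2)\<bar> \<le> \<bar>t\<bar> * (2 * \<bar>t\<bar> / (1 + y\<^sup>2))"
proof -
  obtain s where s: "min (y - t) y \<le> s" "s \<le> max (y - t) y"
    and eq: "arctan y - arctan (y - t) = (y - (y - t)) * inverse (1 + s\<^sup>2)"
    using MVT_between[OF DERIV_arctan, of "y - t" y] by blast
  have sy: "\<bar>s - y\<bar> \<le> \<bar>t\<bar>" using s by (auto simp: min_def max_def split: if_splits)
  have p: "0 < 1 + s\<^sup>2" "0 < 1 + y\<^sup>2" by (auto simp: add_pos_nonneg)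
  have "\<bar>y + s\<bar> \<le> 2 * \<bar>s\<bar> + 1" using sy assms by linarith
  also have "\<dots> \<le> 2 * (1 + s\<^sup>2)"
  proof -
    have "0 \<le> (\<bar>s\<bar> - 1)\<^sup>2" by simp
    then have "2 * \<bar>s\<bar> \<le> 1 + s\<^sup>2" by (simp add: power2_eq_square algebra_simps)
    then have "2 * \<bar>s\<bar> + 1 \<le> 2 + s\<^sup>2" by simp
    also have "\<dots> \<le> 2 * (1 + s\<^sup>2)" by simp
    finally show ?thesis .
  qed
  finally have ys: "\<bar>y + s\<bar> \<le> 2 * (1 + s\<^sup>2)" .
  have "1 / (1 + s\<^sup>2) - 1 / (1 + y\<^sup>2) = (y - s) * (y + s) / ((1 + s\<^sup>2) * (1 + y\<^sup>2))"
    using p by (simp add: field_simps power2_eq_square)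
  then have "\<bar>1 / (1 + s\<^sup>2) - 1 / (1 + y\<^sup>2)\<bar> = \<bar>s - y\<bar> * \<bar>y + s\<bar> / ((1 + s\<^sup>2) * (1 + y\<^sup>2))"
    using p by (simp add: abs_mult abs_minus_commute)
  also have "\<dots> \<le> \<bar>t\<bar> * (2 * (1 + s\<^sup>2)) / ((1 + s\<^sup>2) * (1 + y\<^sup>2))"
    using p sy ys by (intro divide_right_mono mult_mono) auto
  also have "\<dots> = 2 * \<bar>t\<bar> / (1 + y\<^sup>2)" proof -
    have "x * (2 * a) / (a * b) = 2 * x / b" if "0 < a" for a b x :: real
      using that by (cases "b = 0") (auto simp: field_simps)
    then show ?thesis using p by blast
  qed
  finally have "\<bar>t\<bar> * \<bar>1 / (1 + s\<^sup>2) - 1 / (1 + y\<^sup>2)\<bar> \<le> \<bar>t\<bar> * (2 * \<bar>t\<bar> / (1 + y\<^sup>2))"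
    by (intro mult_left_mono) auto
  moreover have "arctan y - arctan (y - t) - t / (1 + y\<^sup>2) = t * (1 / (1 + s\<^sup>2) - 1 / (1 + y\<^sup>2))"
    unfolding eq by (simp add: field_simps)
  ultimately show ?thesis by (simp only: abs_mult)
qed

text \<open>\<open>A i\<close> collects the indices on which summand i may depend.
  \<open>indep1\<close> contains the centering (constant f) and drives the Stein identity;
  \<open>indep2\<close> controls the fluctuation of \<open>V\<close>. \<open>K\<close> compares the
  trivial bound \<open>real (card J) * \<delta>\<^sup>2\<close> with the variance 1.\<close>

locale local_dependence =
  fixes G :: "'w set" and J :: "'j set" and \<xi> :: "'j \<Rightarrow> 'w \<Rightarrow> real" and A :: "'j \<Rightarrow> 'j set"
    and D :: nat and K \<delta> :: real
  assumes G: "finite G" "G \<noteq> {}" and finJ: "finite J"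
    and A_sub: "\<And>i. i \<in> J \<Longrightarrow> A i \<subseteq> J"
    and A_sym: "\<And>i j. i \<in> J \<Longrightarrow> j \<in> A i \<Longrightarrow> i \<in> A j"
    and A_card: "\<And>i. i \<in> J \<Longrightarrow> card (A i) \<le> D"
    and bound: "\<And>i w. i \<in> J \<Longrightarrow> w \<in> G \<Longrightarrow> \<bar>\<xi> i w\<bar> \<le> \<delta>"
    and indep1: "\<And>i f. i \<in> J \<Longrightarrow> avg G (\<lambda>w. \<xi> i w * f (\<Sum>j\<in>J - A i. \<xi> j w)) = 0"
    and indep2: "\<And>i j k l. i \<in> J \<Longrightarrow> j \<in> A i \<Longrightarrow> k \<in> J \<Longrightarrow> l \<in> A k \<Longrightarrow> {k, l} \<inter> (A i \<union> A j) = {} \<Longrightarrow>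
      avg G (\<lambda>w. (\<xi> i w * \<xi> j w) * (\<xi> k w * \<xi> l w))
        = avg G (\<lambda>w. \<xi> i w * \<xi> j w) * avg G (\<lambda>w. \<xi> k w * \<xi> l w)"
    and normalized: "avg G (\<lambda>w. (\<Sum>i\<in>J. \<xi> i w)\<^sup>2) = 1"
    and D1: "1 \<le> D" and K1: "1 \<le> K" and \<delta>_pos: "0 < \<delta>" and K: "real (card J) * \<delta>\<^sup>2 \<le> K"
begin

definition W :: "'w \<Rightarrow> real" where "W w = (\<Sum>i\<in>J. \<xi> i w)"
definition \<eta> :: "'j \<Rightarrow> 'w \<Rightarrow> real" where "\<eta> i w = (\<Sum>j\<in>A i. \<xi> j w)"
text \<open>A random stand-in for the variance: replacing f(W) - f(W - \<eta>) by its linear part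
  turns the average of W f(W) into that of V f'(W).\<close>

definition V :: "'w \<Rightarrow> real" where "V w = (\<Sum>i\<in>J. \<xi> i w * \<eta> i w)"
text \<open>Calibrated so that the linearization error in \<open>concentration\<close>, at most
  \<open>real D * K * (2 * \<kappa> * real D)\<close> times the derivative, is half of the
  derivative.\<close>

definition \<kappa> :: real where "\<kappa> = 1 / (4 * real D ^ 2 * K)"
definition c1 :: real where "c1 = sqrt (8 * real D ^ 3 * K)"

lemma \<eta>_bound: "i \<in> J \<Longrightarrow> w \<in> G \<Longrightarrow> \<bar>\<eta> i w\<bar> \<le> real D * \<delta>"
proof -
  assume i: "i \<in> J" and w: "w \<in> G"
  have "\<bar>\<eta> i w\<bar> \<le> (\<Sum>j\<in>A i. \<bar>\<xi> j w\<bar>)" by (simp add: \<eta>_def)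
  also have "\<dots> \<le> real (card (A i)) * \<delta>"
    using A_sub[OF i] w bound by (intro sum_bounded_above) auto
  also have "\<dots> \<le> real D * \<delta>" using A_card[OF i] \<delta>_pos by simp
  finally show ?thesis .
qed

text \<open>\<open>card J\<close> terms of size \<delta> times D \<delta> stay bounded because
  \<open>real (card J) * \<delta>\<^sup>2\<close> is at most \<open>K\<close>; the smallness of a
  remainder sits in \<open>h\<close>.\<close>

lemma sum_J_bound:
  assumes w: "w \<in> G" and h: "\<And>i. i \<in> J \<Longrightarrow> 0 \<le> h i \<and> h i \<le> b" and b: "0 \<le> b"
  shows "(\<Sum>i\<in>J. \<bar>\<xi> i w\<bar> * (\<bar>\<eta> i w\<bar> * h i)) \<le> real D * K * b"
proof -
  have "(\<Sum>i\<in>J. \<bar>\<xi> i w\<bar> * (\<bar>\<eta> i w\<bar> * h i)) \<le> real (card J) * (\<delta> * (real D * \<delta> * b))"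
    using h bound[OF _ w] \<eta>_bound[OF _ w] b \<delta>_pos
    by (intro sum_bounded_above mult_mono) auto
  also have "\<dots> = (real (card J) * \<delta>\<^sup>2) * (real D * b)" by (simp add: power2_eq_square)
  also have "\<dots> \<le> K * (real D * b)" using K b by (intro mult_right_mono) auto
  finally show ?thesis by (simp add: mult_ac)
qed

text \<open>The Stein identity: \<open>W w - \<eta> i w\<close> is the sum outside the neighbourhood
  of i, so by \<open>indep1\<close> the subtracted terms average to 0.\<close>

lemma avg_W_mult:
  "avg G (\<lambda>w. W w * f (W w)) = avg G (\<lambda>w. \<Sum>i\<in>J. \<xi> i w * (f (W w) - f (W w - \<eta> i w)))"
proof -
  have "(\<Sum>j\<in>J - A i. \<xi> j w) = W w - \<eta> i w" if "i \<in> J" for i w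
    using A_sub[OF that] finJ by (simp add: W_def \<eta>_def sum_diff)
  then have z: "avg G (\<lambda>w. \<xi> i w * f (W w - \<eta> i w)) = 0" if "i \<in> J" for i
    using indep1[OF that, of f] that by simp
  have "avg G (\<lambda>w. \<Sum>i\<in>J. \<xi> i w * (f (W w) - f (W w - \<eta> i w)))
    = (\<Sum>i\<in>J. avg G (\<lambda>w. \<xi> i w * f (W w)) - avg G (\<lambda>w. \<xi> i w * f (W w - \<eta> i w)))"
    by (simp add: avg_sum right_diff_distrib avg_diff)
  also have "\<dots> = avg G (\<lambda>w. \<Sum>i\<in>J. \<xi> i w * f (W w))" using z by (simp add: avg_sum)
  finally show ?thesis by (simp add: W_def sum_distrib_right)
qed

lemma avg_V: "avg G V = 1"
  using avg_W_mult[of "\<lambda>x. x"] normalized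
  by (simp add: V_def[abs_def] W_def power2_eq_square)

lemma avg_abs_W: "avg G (\<lambda>w. \<bar>W w\<bar>) \<le> 1"
  using avg_abs_le_sqrt[OF G, of W] normalized by (simp add: W_def)

text \<open>The variance of \<open>V\<close> is a sum of covariances of products. There are at most
  \<open>card J * D\<close> products, each correlated with at most \<open>4 * D\<^sup>2\<close> of
  them, and a covariance is at most \<open>2 * \<delta> ^ 4\<close>; this is the origin of
  \<open>c1\<close>.\<close>

lemma avg_V_dev: "avg G (\<lambda>w. \<bar>V w - 1\<bar>) \<le> c1 * \<delta>"
proof -
  define P where "P = Sigma J A"
  define Z where "Z = (\<lambda>(i,j) w. \<xi> i w * \<xi> j w)"
  define bad where "bad = (\<lambda>(i,j). {(k,l) \<in> P. {k, l} \<inter> (A i \<union> A j) \<noteq> {}})"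
  define cv where "cv = (\<lambda>p q. avg G (\<lambda>w. Z p w * Z q w) - avg G (Z p) * avg G (Z q))"
  have finA: "finite (A i)" if "i \<in> J" for i using A_sub[OF that] finJ finite_subset by blast
  have finP: "finite P" using finJ finA by (auto simp: P_def)
  have VP: "V w = (\<Sum>p\<in>P. Z p w)" for w
    unfolding V_def \<eta>_def P_def Z_def using finJ finA
    by (simp add: sum.Sigma sum_distrib_left split_def)
  have PJ: "fst p \<in> J" "snd p \<in> J" if "p \<in> P" for p
    using that A_sub by (auto simp: P_def subset_iff)
  have Zb: "\<bar>Z p w\<bar> \<le> \<delta>\<^sup>2" if "p \<in> P" "w \<in> G" for p w
    using bound[OF PJ(1)[OF that(1)] that(2)] bound[OF PJ(2)[OF that(1)] that(2)] \<delta>_pos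
    by (auto simp: Z_def split_beta abs_mult power2_eq_square intro!: mult_mono)
  have avb: "\<bar>avg G g\<bar> \<le> b" if "\<And>w. w \<in> G \<Longrightarrow> \<bar>g w\<bar> \<le> b" for g b
    using abs_avg_le[of G g] avg_mono[of G "\<lambda>w. \<bar>g w\<bar>" "\<lambda>_. b"] that avg_const[OF G, of b] by fastforce
  have cvb: "cv p q \<le> 2 * \<delta> ^ 4" if "p \<in> P" "q \<in> P" for p q
  proof -
    have "\<bar>avg G (\<lambda>w. Z p w * Z q w)\<bar> \<le> \<delta>\<^sup>2 * \<delta>\<^sup>2"
      using Zb that by (intro avb, unfold abs_mult, intro mult_mono) auto
    moreover have "\<bar>avg G (Z p) * avg G (Z q)\<bar> \<le> \<delta>\<^sup>2 * \<delta>\<^sup>2"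
      using Zb that unfolding abs_mult by (intro mult_mono avb) auto
    ultimately show ?thesis by (simp add: cv_def power4_eq_xxxx power2_eq_square)
  qed
  have cv0: "cv p q = 0" if "p \<in> P" "q \<in> P - bad p" for p q
    using that indep2[of "fst p" "snd p" "fst q" "snd q"]
    by (auto simp: cv_def P_def Z_def bad_def split_beta)
  have cbad: "card (bad p) \<le> 4 * D\<^sup>2" if "p \<in> P" for p
  proof -
    define U where "U = A (fst p) \<union> A (snd p)"
    have UJ: "U \<subseteq> J" using PJ[OF that] A_sub by (auto simp: U_def)
    have cU: "card U \<le> 2 * D"
      using card_Un_le[of "A (fst p)" "A (snd p)"] A_card[OF PJ(1)[OF that]] A_card[OF PJ(2)[OF that]]
      by (simp add: U_def)
    have finU: "finite U" using UJ finJ finite_subset by blast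
    have cS: "card (Sigma U A) \<le> 2 * D\<^sup>2"
    proof -
      have "card (Sigma U A) = (\<Sum>k\<in>U. card (A k))"
        using UJ finA finU by (intro card_SigmaI) auto
      also have "\<dots> \<le> card U * D" using UJ A_card sum_bounded_above[of U "\<lambda>k. card (A k)" D] by auto
      also have "\<dots> \<le> 2 * D * D" using cU by simp
      finally show ?thesis by (simp add: power2_eq_square)
    qed
    have finS: "finite (Sigma U A)" using finU finA UJ by blast
    \<comment> \<open>A bad pair meets \<open>U\<close> in its first or its second index; by
      symmetry of \<open>A\<close> the latter kind is a swapped pair starting in
      \<open>U\<close>.\<close>
    have "bad p \<subseteq> Sigma U A \<union> prod.swap ` Sigma U A"
      using A_sym by (force simp: bad_def P_def U_def image_iff split: prod.splits)
    then have "card (bad p) \<le> card (Sigma U A \<union> prod.swap ` Sigma U A)"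
      using finS by (intro card_mono) auto
    also have "\<dots> \<le> card (Sigma U A) + card (prod.swap ` Sigma U A)" by (rule card_Un_le)
    also have "\<dots> \<le> card (Sigma U A) + card (Sigma U A)" using finS card_image_le by auto
    finally show ?thesis using cS by simp
  qed
  have cP: "card P \<le> card J * D"
    unfolding P_def using finJ finA A_card sum_bounded_above[of J "\<lambda>k. card (A k)" D]
    by (subst card_SigmaI) auto
  have "avg G (\<lambda>w. (V w - 1)\<^sup>2) = avg G (\<lambda>w. V w * V w - 2 * V w + 1)"
    by (intro avg_cong) (simp add: power2_eq_square algebra_simps)
  also have "\<dots> = avg G (\<lambda>w. V w * V w) - avg G V * avg G V"
    by (simp add: avg_add avg_diff avg_cmult avg_V avg_const[OF G])
  also have "\<dots> = (\<Sum>p\<in>P. \<Sum>q\<in>P. cv p q)"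
    unfolding VP[abs_def] cv_def by (simp add: sum_product avg_sum sum_subtractf)
  also have "\<dots> \<le> (\<Sum>p\<in>P. real (4 * D\<^sup>2) * (2 * \<delta> ^ 4))"
  proof (rule sum_mono)
    fix p assume p: "p \<in> P"
    have bP: "bad p \<subseteq> P" by (auto simp: bad_def split: prod.splits)
    have "(\<Sum>q\<in>P. cv p q) = (\<Sum>q\<in>bad p. cv p q)"
      using cv0[OF p] bP finP by (intro sum.mono_neutral_right) auto
    also have "\<dots> \<le> real (card (bad p)) * (2 * \<delta> ^ 4)"
      using cvb[OF p] bP by (intro sum_bounded_above) auto
    also have "\<dots> \<le> real (4 * D\<^sup>2) * (2 * \<delta> ^ 4)"
      using cbad[OF p] \<delta>_pos by (intro mult_right_mono) (simp_all flip: of_nat_power)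
    finally show "(\<Sum>q\<in>P. cv p q) \<le> real (4 * D\<^sup>2) * (2 * \<delta> ^ 4)" .
  qed
  also have "\<dots> = real (card P) * (real (4 * D\<^sup>2) * (2 * \<delta> ^ 4))" by simp
  also have "\<dots> \<le> real (card J * D) * (real (4 * D\<^sup>2) * (2 * \<delta> ^ 4))"
    using cP \<delta>_pos by (intro mult_right_mono of_nat_mono) auto
  also have "\<dots> = (8 * real D ^ 3 * \<delta>\<^sup>2) * (real (card J) * \<delta>\<^sup>2)"
    by (simp add: power2_eq_square power3_eq_cube power4_eq_xxxx)
  also have "\<dots> \<le> (8 * real D ^ 3 * \<delta>\<^sup>2) * K" using K by (intro mult_left_mono) auto
  finally have "avg G (\<lambda>w. (V w - 1)\<^sup>2) \<le> (8 * real D ^ 3 * K) * \<delta>\<^sup>2" by (simp add: mult_ac)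
  then have "sqrt (avg G (\<lambda>w. (V w - 1)\<^sup>2)) \<le> sqrt ((8 * real D ^ 3 * K) * \<delta>\<^sup>2)"
    by (rule real_sqrt_le_mono)
  also have "\<dots> = c1 * \<delta>" using \<delta>_pos unfolding c1_def real_sqrt_mult by simp
  finally show ?thesis using avg_abs_le_sqrt[OF G, of "\<lambda>w. V w - 1"] by simp
qed

lemma \<kappa>: "0 < \<kappa>" "\<kappa> * real D \<le> 1" "real D * K * (2 * \<kappa> * real D) = 1/2"
proof -
  have D: "1 \<le> real D" using D1 by simp
  show "0 < \<kappa>" using D K1 by (simp add: \<kappa>_def)
  have "real D * 1 \<le> real D * (4 * real D * K)"
    using D K1 mult_mono[of 1 "4 * real D" 1 K] by (intro mult_left_mono) auto
  then show "\<kappa> * real D \<le> 1" using D K1 by (simp add: \<kappa>_def field_simps power2_eq_square)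
  show "real D * K * (2 * \<kappa> * real D) = 1/2"
    using D K1 by (simp add: \<kappa>_def field_simps power2_eq_square)
qed

text \<open>Twice the bound \<open>4 / \<kappa> + 2 * c1\<close> for the average of f' in units of
  \<delta>, because f' is at least 1/2 on the window around z.\<close>

definition c2 :: real where "c2 = 8 / \<kappa> + 4 * c1"

text \<open>Test function \<open>f(x) = (\<delta>/\<kappa>) arctan(\<kappa>(x - z)/\<delta>)\<close>: the logarithmic derivative of \<open>f'\<close> is at
  most of the order \<open>\<kappa>/\<delta>\<close>, so that the increments of \<open>f\<close> over steps of size \<open>D\<delta>\<close> are, up to a
  small multiple of \<open>f'\<close>, those of its linearization. Hence the expectation of \<open>W f(W)\<close>, which is
  of the order \<open>\<delta>\<close>, controls that of \<open>f'(W)\<close>.\<close>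
lemma concentration: "avg G (\<lambda>w. of_bool (\<bar>W w - z\<bar> \<le> real D * \<delta>)) \<le> c2 * \<delta>"
proof -
  define y where "y = (\<lambda>x. \<kappa> * (x - z) / \<delta>)"
  define f where "f = (\<lambda>x. \<delta> / \<kappa> * arctan (y x))"
  define f' where "f' = (\<lambda>x. 1 / (1 + (y x)\<^sup>2))"
  have q: "1 \<le> 1 + (y x)\<^sup>2" for x by simp
  have f'01: "0 \<le> f' x" "f' x \<le> 1" for x
    using frac_le[of 1 1 1 "1 + (y x)\<^sup>2"] by (auto simp: f'_def)
  have fb: "\<bar>f x\<bar> \<le> 2 * \<delta> / \<kappa>" for x
  proof -
    have "\<bar>arctan (y x)\<bar> \<le> 2"
      using arctan_lbound[of "y x"] arctan_ubound[of "y x"] pi_less_4 by linarith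
    then have "\<delta> / \<kappa> * \<bar>arctan (y x)\<bar> \<le> \<delta> / \<kappa> * 2" using \<delta>_pos \<kappa>(1) by (intro mult_left_mono) auto
    then show ?thesis using \<delta>_pos \<kappa>(1) by (simp add: f_def abs_mult mult_ac)
  qed
  have rem: "\<bar>f x - f (x - h) - h * f' x\<bar> \<le> \<bar>h\<bar> * (2 * \<kappa> * real D * f' x)" if h: "\<bar>h\<bar> \<le> real D * \<delta>" for x h
  proof -
    define t where "t = \<kappa> * h / \<delta>"
    have "\<kappa> * \<bar>h\<bar> \<le> \<kappa> * (real D * \<delta>)" using h \<kappa>(1) by (intro mult_left_mono) auto
    then have tD: "\<bar>t\<bar> \<le> \<kappa> * real D"
      using \<delta>_pos \<kappa>(1) by (simp add: t_def abs_mult field_simps)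
    then have t1: "\<bar>t\<bar> \<le> 1" using \<kappa>(2) by linarith
    have yt: "y (x - h) = y x - t" by (simp add: y_def t_def diff_divide_distrib algebra_simps)
    have ht: "h = \<delta> / \<kappa> * t" using \<delta>_pos \<kappa>(1) by (simp add: t_def)
    have "f x - f (x - h) - h * f' x = \<delta> / \<kappa> * (arctan (y x) - arctan (y x - t) - t / (1 + (y x)\<^sup>2))"
      unfolding f_def yt f'_def by (subst ht) (simp add: algebra_simps)
    then have "\<bar>f x - f (x - h) - h * f' x\<bar> = \<delta> / \<kappa> * \<bar>arctan (y x) - arctan (y x - t) - t / (1 + (y x)\<^sup>2)\<bar>"
      using \<delta>_pos \<kappa>(1) by (simp add: abs_mult)
    also have "\<dots> \<le> \<delta> / \<kappa> * (\<bar>t\<bar> * (2 * \<bar>t\<bar> / (1 + (y x)\<^sup>2)))"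
      using \<delta>_pos \<kappa>(1) by (intro mult_left_mono arctan_remainder t1) auto
    also have "\<dots> = \<bar>h\<bar> * (2 * \<bar>t\<bar> * f' x)"
      using \<delta>_pos \<kappa>(1) by (subst ht) (simp add: abs_mult f'_def)
    also have "\<dots> \<le> \<bar>h\<bar> * (2 * (\<kappa> * real D) * f' x)"
      using tD f'01 by (intro mult_left_mono mult_right_mono) auto
    finally show ?thesis by (simp add: mult_ac)
  qed
  \<comment> \<open>The error takes at most half of f', and replacing \<open>V\<close> by 1 costs |V
    - 1| because 0 \<le> f' \<le> 1.\<close>
  have lower: "f' (W w) / 2 - \<bar>V w - 1\<bar> \<le> (\<Sum>i\<in>J. \<xi> i w * (f (W w) - f (W w - \<eta> i w)))" if w: "w \<in> G" for w
  proof -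
    define e where "e = (\<lambda>i. f (W w) - f (W w - \<eta> i w) - \<eta> i w * f' (W w))"
    have "\<bar>\<Sum>i\<in>J. \<xi> i w * e i\<bar> \<le> (\<Sum>i\<in>J. \<bar>\<xi> i w\<bar> * (\<bar>\<eta> i w\<bar> * (2 * \<kappa> * real D * f' (W w))))"
    proof (rule order_trans[OF sum_abs sum_mono])
      fix i assume "i \<in> J"
      then show "\<bar>\<xi> i w * e i\<bar> \<le> \<bar>\<xi> i w\<bar> * (\<bar>\<eta> i w\<bar> * (2 * \<kappa> * real D * f' (W w)))"
        unfolding abs_mult e_def using rem[OF \<eta>_bound[OF _ w]] by (intro mult_left_mono) auto
    qed
    also have "\<dots> \<le> real D * K * (2 * \<kappa> * real D * f' (W w))"
      using \<kappa>(1) f'01 by (intro sum_J_bound w) auto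
    also have "\<dots> = f' (W w) / 2" using \<kappa>(3) by (metis mult.assoc mult.commute times_divide_eq_right mult.right_neutral)
    finally have "- (f' (W w) / 2) \<le> (\<Sum>i\<in>J. \<xi> i w * e i)" by linarith
    moreover have "(\<Sum>i\<in>J. \<xi> i w * (f (W w) - f (W w - \<eta> i w))) = (\<Sum>i\<in>J. \<xi> i w * e i) + f' (W w) * V w"
      by (simp add: e_def V_def sum_distrib_left sum.distrib[symmetric] algebra_simps)
    moreover have "- \<bar>V w - 1\<bar> \<le> f' (W w) * (V w - 1)"
    proof -
      have "\<bar>f' (W w) * (V w - 1)\<bar> \<le> \<bar>V w - 1\<bar>"
        unfolding abs_mult using f'01[of "W w"] by (simp add: mult_left_le_one_le)
      then show ?thesis by linarith
    qed
    ultimately show ?thesis by (simp add: algebra_simps)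
  qed
  have "avg G (\<lambda>w. f' (W w)) / 2 - avg G (\<lambda>w. \<bar>V w - 1\<bar>) = avg G (\<lambda>w. 1/2 * f' (W w) - \<bar>V w - 1\<bar>)"
    by (simp only: avg_diff avg_cmult)
  also have "\<dots> \<le> avg G (\<lambda>w. \<Sum>i\<in>J. \<xi> i w * (f (W w) - f (W w - \<eta> i w)))"
    using lower by (intro avg_mono) simp
  also have "\<dots> = avg G (\<lambda>w. W w * f (W w))" by (simp add: avg_W_mult)
  also have "\<dots> \<le> avg G (\<lambda>w. 2 * \<delta> / \<kappa> * \<bar>W w\<bar>)"
  proof (rule avg_mono)
    fix w
    have "W w * f (W w) \<le> \<bar>W w\<bar> * \<bar>f (W w)\<bar>" by (metis abs_ge_self abs_mult)
    also have "\<dots> \<le> \<bar>W w\<bar> * (2 * \<delta> / \<kappa>)" by (intro mult_left_mono fb) auto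
    finally show "W w * f (W w) \<le> 2 * \<delta> / \<kappa> * \<bar>W w\<bar>" by (simp add: mult.commute)
  qed
  also have "\<dots> \<le> 2 * \<delta> / \<kappa>"
    unfolding avg_cmult using mult_left_mono[OF avg_abs_W, of "2 * \<delta> / \<kappa>"] \<delta>_pos \<kappa>(1) by simp
  finally have main: "avg G (\<lambda>w. f' (W w)) \<le> 4 * \<delta> / \<kappa> + 2 * (c1 * \<delta>)"
    using avg_V_dev by linarith
  \<comment> \<open>Since \<open>\<kappa> * real D\<close> \<le> 1, the window lies in |y| \<le> 1,
    where f' is at least 1/2.\<close>
  have "avg G (\<lambda>w. of_bool (\<bar>W w - z\<bar> \<le> real D * \<delta>)) \<le> avg G (\<lambda>w. 2 * f' (W w))"
  proof (rule avg_mono)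
    fix w
    show "of_bool (\<bar>W w - z\<bar> \<le> real D * \<delta>) \<le> 2 * f' (W w)"
    proof (cases "\<bar>W w - z\<bar> \<le> real D * \<delta>")
      case True
      then have "\<kappa> * \<bar>W w - z\<bar> \<le> \<kappa> * (real D * \<delta>)" using \<kappa>(1) by (intro mult_left_mono) auto
      also have "\<dots> \<le> 1 * \<delta>" using mult_right_mono[OF \<kappa>(2), of \<delta>] \<delta>_pos by (simp add: mult.assoc)
      finally have "\<bar>y (W w)\<bar> \<le> 1" using \<delta>_pos \<kappa>(1) by (simp add: y_def abs_mult)
      then have "(y (W w))\<^sup>2 \<le> 1" by (simp add: abs_square_le_1)
      then have "1 / 2 \<le> f' (W w)" unfolding f'_def using q[of "W w"] by (intro frac_le) linarith+
      then show ?thesis using True by simp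
    qed (use f'01 in auto)
  qed
  also have "\<dots> \<le> c2 * \<delta>" using mult_left_mono[OF main, of 2]
    by (simp add: avg_cmult c2_def distrib_left distrib_right mult_ac)
  finally show ?thesis .
qed

text \<open>The first term pays for replacing \<open>V\<close> by 1 under a derivative of size at
  most 2, the second for the linearization error, whose kink part is bounded by
  \<open>concentration\<close>.\<close>

definition c3 :: real where "c3 = 2 * c1 + real D * K * (4 * real D + 4 * c2)"

text \<open>Averaging the Stein equation at \<open>W\<close> and inserting \<open>avg_W_mult\<close>
  leaves F'(W) (1 - V) minus the linearization error \<open>R\<close>.\<close>

theorem berry_esseen: "\<bar>avg G (\<lambda>w. of_bool (W w \<le> z)) - ncdf z\<bar> \<le> c3 * \<delta>"
proof -
  define F where "F = stein_sol z"
  define F' where "F' = stein_der z"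
  \<comment> \<open>One bound for all i: since |\<eta>| \<le> D \<delta>, the kink windows of all
    increments fit into a single one.\<close>
  define b where "b = (\<lambda>w. (2 * \<bar>W w\<bar> + 2) * (real D * \<delta>) + 4 * of_bool (\<bar>W w - z\<bar> \<le> real D * \<delta>))"
  define R where "R = (\<lambda>w. \<Sum>i\<in>J. \<xi> i w * (F (W w) - F (W w - \<eta> i w) - \<eta> i w * F' (W w)))"
  have Rb: "\<bar>R w\<bar> \<le> real D * K * b w" if w: "w \<in> G" for w
  proof -
    define h where "h = (\<lambda>i. (2 * \<bar>W w\<bar> + 2) * \<bar>\<eta> i w\<bar> + 4 * of_bool (\<bar>W w - z\<bar> \<le> \<bar>\<eta> i w\<bar>))"
    have "\<bar>R w\<bar> \<le> (\<Sum>i\<in>J. \<bar>\<xi> i w\<bar> * (\<bar>\<eta> i w\<bar> * h i))"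
      unfolding R_def F_def F'_def h_def
      by (rule order_trans[OF sum_abs sum_mono]) (simp only: abs_mult mult_left_mono[OF stein_remainder] abs_ge_zero)
    also have "\<dots> \<le> real D * K * b w"
    proof (rule sum_J_bound[OF w])
      fix i assume i: "i \<in> J"
      have "(2 * \<bar>W w\<bar> + 2) * \<bar>\<eta> i w\<bar> \<le> (2 * \<bar>W w\<bar> + 2) * (real D * \<delta>)"
        by (intro mult_left_mono \<eta>_bound i w) auto
      moreover have "of_bool (\<bar>W w - z\<bar> \<le> \<bar>\<eta> i w\<bar>) \<le> (of_bool (\<bar>W w - z\<bar> \<le> real D * \<delta>) :: real)"
        using \<eta>_bound[OF i w] by auto
      ultimately show "0 \<le> h i \<and> h i \<le> b w" by (auto simp: h_def b_def)
    qed (use \<delta>_pos in \<open>auto simp: b_def\<close>)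
    finally show ?thesis .
  qed
  have "avg G b = 2 * real D * \<delta> * avg G (\<lambda>w. \<bar>W w\<bar>) + 2 * real D * \<delta>
      + 4 * avg G (\<lambda>w. of_bool (\<bar>W w - z\<bar> \<le> real D * \<delta>))"
  proof -
    have "b = (\<lambda>w. 2 * real D * \<delta> * \<bar>W w\<bar> + 2 * real D * \<delta> + 4 * of_bool (\<bar>W w - z\<bar> \<le> real D * \<delta>))"
      by (auto simp: b_def algebra_simps)
    then show ?thesis by (simp only: avg_add avg_cmult avg_const[OF G])
  qed
  also have "\<dots> \<le> 2 * real D * \<delta> * 1 + 2 * real D * \<delta> + 4 * (c2 * \<delta>)"
    using \<delta>_pos by (intro add_mono mult_left_mono avg_abs_W concentration order_refl) auto
  finally have avb: "avg G b \<le> (4 * real D + 4 * c2) * \<delta>" by (simp add: algebra_simps)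
  have "avg G (\<lambda>w. of_bool (W w \<le> z)) - ncdf z = avg G (\<lambda>w. F' (W w) - W w * F (W w))"
    using avg_diff[of G "\<lambda>w. of_bool (W w \<le> z)" "\<lambda>w. ncdf z"] avg_const[OF G, of "ncdf z"]
    by (simp add: F'_def F_def stein_der_def)
  also have "\<dots> = avg G (\<lambda>w. F' (W w)) - avg G (\<lambda>w. \<Sum>i\<in>J. \<xi> i w * (F (W w) - F (W w - \<eta> i w)))"
    by (simp only: avg_diff avg_W_mult)
  also have "(\<lambda>w. \<Sum>i\<in>J. \<xi> i w * (F (W w) - F (W w - \<eta> i w))) = (\<lambda>w. R w + F' (W w) * V w)"
    by (simp add: R_def V_def sum_distrib_left sum.distrib[symmetric] algebra_simps)
  also have "avg G (\<lambda>w. F' (W w)) - avg G (\<lambda>w. R w + F' (W w) * V w)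
      = avg G (\<lambda>w. F' (W w) * (1 - V w) - R w)"
    by (simp only: avg_diff[symmetric]) (simp add: algebra_simps)
  also have "\<bar>\<dots>\<bar> \<le> avg G (\<lambda>w. \<bar>F' (W w) * (1 - V w) - R w\<bar>)" by (rule abs_avg_le)
  also have "\<dots> \<le> avg G (\<lambda>w. 2 * \<bar>V w - 1\<bar> + real D * K * b w)"
  proof (rule avg_mono)
    fix w assume w: "w \<in> G"
    have "\<bar>F' (W w) * (1 - V w)\<bar> \<le> 2 * \<bar>V w - 1\<bar>"
      unfolding abs_mult abs_minus_commute[of 1] F'_def
      by (intro mult_right_mono stein_der_bound) auto
    then show "\<bar>F' (W w) * (1 - V w) - R w\<bar> \<le> 2 * \<bar>V w - 1\<bar> + real D * K * b w"
      using Rb[OF w] by linarith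
  qed
  also have "\<dots> = 2 * avg G (\<lambda>w. \<bar>V w - 1\<bar>) + real D * K * avg G b"
    by (simp only: avg_add avg_cmult)
  also have "\<dots> \<le> 2 * (c1 * \<delta>) + real D * K * ((4 * real D + 4 * c2) * \<delta>)"
    using K1 avb avg_V_dev by (intro add_mono mult_left_mono) auto
  also have "\<dots> = c3 * \<delta>" by (simp add: c3_def algebra_simps)
  finally show ?thesis .
qed

end

section \<open>Root systems and reflection groups\<close>

lemma ip_commute: "ip d u v = ip d v u"
  by (simp add: ip_def mult.commute)

lemma ip_add_left: "ip d (\<lambda>i. u i + v i) w = ip d u w + ip d v w"
  by (simp add: ip_def sum.distrib algebra_simps)

lemma ip_diff_left: "ip d (\<lambda>i. u i - v i) w = ip d u w - ip d v w"
  by (simp add: ip_def sum_subtractf algebra_simps)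

lemma ip_scale_left: "ip d (\<lambda>i. c * u i) w = c * ip d u w"
  by (simp add: ip_def sum_distrib_left mult_ac)

lemma ip_minus_left: "ip d (\<lambda>i. - u i) w = - ip d u w"
  by (simp add: ip_def sum_negf)

lemma ip_add_right: "ip d w (\<lambda>i. u i + v i) = ip d w u + ip d w v"
  using ip_add_left ip_commute by metis

lemma ip_diff_right: "ip d w (\<lambda>i. u i - v i) = ip d w u - ip d w v"
  using ip_diff_left ip_commute by metis

lemma ip_scale_right: "ip d w (\<lambda>i. c * u i) = c * ip d w u"
  using ip_scale_left ip_commute by metis

lemma ip_minus_right: "ip d w (\<lambda>i. - u i) = - ip d w u"
  using ip_minus_left ip_commute by metis

lemmas ip_linear = ip_add_left ip_diff_left ip_scale_left ip_minus_left
  ip_add_right ip_diff_right ip_scale_right ip_minus_right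

lemma ip_sum_left: "ip d (\<lambda>i. \<Sum>a\<in>B. f a i) v = (\<Sum>a\<in>B. ip d (f a) v)"
  by (simp add: ip_def sum_distrib_right sum.swap[of _ B])

lemma ip_lin_comb: "ip d (lin_comb B c) v = (\<Sum>a\<in>B. c a * ip d a v)"
  by (simp add: lin_comb_def ip_sum_left ip_scale_left)

lemma ip_lin_comb_right: "ip d v (lin_comb B c) = (\<Sum>a\<in>B. c a * ip d v a)"
  using ip_lin_comb ip_commute by (metis (no_types, lifting) sum.cong)

lemma ip_self_nonneg: "0 \<le> ip d v v"
  by (simp add: ip_def sum_nonneg)

text \<open>\<open>ip d\<close> sees only the first d coordinates; membership in
  \<open>evec d\<close> accounts for the others.\<close>

lemma ip_self_eq_0: "v \<in> evec d \<Longrightarrow> ip d v v \<le> 0 \<Longrightarrow> v = (\<lambda>i. 0)"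
proof -
  assume v: "v \<in> evec d" and "ip d v v \<le> 0"
  then have "(\<Sum>i<d. v i * v i) = 0" using ip_self_nonneg[of d v] by (simp add: ip_def)
  then have "\<forall>i<d. v i = 0" by (subst (asm) sum_nonneg_eq_0_iff) auto
  then show ?thesis using v by (auto simp: evec_def not_less[symmetric])
qed

lemma lin_comb_cong: "(\<And>a. a \<in> B \<Longrightarrow> c a = e a) \<Longrightarrow> lin_comb B c = lin_comb B e"
  by (simp add: lin_comb_def)

lemma lin_comb_add: "(\<lambda>i. lin_comb B c i + lin_comb B e i) = lin_comb B (\<lambda>a. c a + e a)"
  by (simp add: lin_comb_def sum.distrib algebra_simps)

lemma lin_comb_diff: "(\<lambda>i. lin_comb B c i - lin_comb B e i) = lin_comb B (\<lambda>a. c a - e a)"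
  by (simp add: lin_comb_def sum_subtractf algebra_simps)

lemma lin_comb_uminus: "(\<lambda>i. - lin_comb B c i) = lin_comb B (\<lambda>a. - c a)"
  by (simp add: lin_comb_def sum_negf)

lemma lin_comb_single: "finite B \<Longrightarrow> a \<in> B \<Longrightarrow> lin_comb B (\<lambda>b. if b = a then x else 0) = (\<lambda>i. x * a i)"
  by (simp add: lin_comb_def if_distrib[of "\<lambda>x. x * _"] cong: if_cong)

lemma lin_comb_in_evec: "B \<subseteq> evec d \<Longrightarrow> lin_comb B c \<in> evec d"
  by (auto simp: evec_def lin_comb_def subset_iff intro!: sum.neutral)

section \<open>Reflections, isometries and linear functionals\<close>

definition cartan :: "nat \<Rightarrow> (nat \<Rightarrow> real) \<Rightarrow> (nat \<Rightarrow> real) \<Rightarrow> real" where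
  "cartan d v a = 2 * ip d v a / ip d a a"

lemma reflect_root_eq: "reflect_root d a v = (\<lambda>i. v i - cartan d v a * a i)"
  by (simp add: reflect_root_def cartan_def)

definition linear_functional :: "((nat \<Rightarrow> real) \<Rightarrow> real) \<Rightarrow> bool" where
  "linear_functional L \<longleftrightarrow> (\<forall>x u v. L (\<lambda>i. x * u i + v i) = x * L u + L v)"

lemma linear_functional_sum:
  assumes "linear_functional L"
  shows "L (\<lambda>i. \<Sum>a\<in>B. c a * f a i) = (\<Sum>a\<in>B. c a * L (f a))"
proof -
  have 0: "L (\<lambda>i. 0) = 0"
    using assms[unfolded linear_functional_def, rule_format, of 1 "\<lambda>i. 0" "\<lambda>i. 0"] by simp
  show ?thesis
    using assms by (induction B rule: infinite_finite_induct) (auto simp: 0 linear_functional_def)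
qed

definition isometry :: "nat \<Rightarrow> ((nat \<Rightarrow> real) \<Rightarrow> (nat \<Rightarrow> real)) \<Rightarrow> bool" where
  "isometry d w \<longleftrightarrow> (\<forall>x u v. w (\<lambda>i. x * u i + v i) = (\<lambda>i. x * w u i + w v i)) \<and>
    (\<forall>u v. ip d (w u) (w v) = ip d u v)"

lemma isometry_affine: "isometry d w \<Longrightarrow> w (\<lambda>i. x * u i + v i) = (\<lambda>i. x * w u i + w v i)"
  by (simp add: isometry_def)

lemma isometry_ip: "isometry d w \<Longrightarrow> ip d (w u) (w v) = ip d u v"
  by (simp add: isometry_def)

lemma isometry_minus: "isometry d w \<Longrightarrow> w (\<lambda>i. - u i) = (\<lambda>i. - w u i)"
proof -
  assume w: "isometry d w"
  have "w (\<lambda>i. 0) i = 0" for i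
    using fun_cong[OF isometry_affine[OF w, of 1 "\<lambda>i. 0" "\<lambda>i. 0"], of i] by simp
  then show ?thesis using isometry_affine[OF w, of "-1" u "\<lambda>i. 0"] by simp
qed

lemma isometry_id: "isometry d id"
  by (simp add: isometry_def)

lemma isometry_comp: "isometry d w \<Longrightarrow> isometry d v \<Longrightarrow> isometry d (w \<circ> v)"
  by (simp add: isometry_def)

lemma linear_functional_ip: "linear_functional (ip d r)"
  by (simp add: linear_functional_def ip_linear)

lemma linear_functional_comp: "linear_functional L \<Longrightarrow> isometry d w \<Longrightarrow> linear_functional (\<lambda>v. L (w v))"
  by (simp add: linear_functional_def isometry_affine)

lemma isometry_reflect: "ip d a a \<noteq> 0 \<Longrightarrow> isometry d (reflect_root d a)"
proof -
  assume a: "ip d a a \<noteq> 0"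
  have "reflect_root d a (\<lambda>i. x * u i + v i) = (\<lambda>i. x * reflect_root d a u i + reflect_root d a v i)" for x u v
    by (simp add: reflect_root_eq cartan_def ip_linear add_divide_distrib algebra_simps)
  moreover have "ip d (reflect_root d a u) (reflect_root d a v) = ip d u v" for u v
  proof -
    define p where "p = cartan d u a"
    define q where "q = cartan d v a"
    have "p * (q * ip d a a) = p * (2 * ip d v a)" "q * (p * ip d a a) = q * (2 * ip d u a)"
      using a by (simp_all add: p_def q_def cartan_def)
    then show ?thesis
      unfolding reflect_root_eq ip_linear ip_commute[of d a v] p_def[symmetric] q_def[symmetric]
      by (simp only: right_diff_distrib mult.left_commute[of q p])
  qed
  ultimately show ?thesis by (simp add: isometry_def)
qed

lemma reflect_self: "ip d a a \<noteq> 0 \<Longrightarrow> reflect_root d a a = (\<lambda>i. - a i)"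
  by (simp add: reflect_root_eq cartan_def)

lemma ip_reflect_self: "ip d a a \<noteq> 0 \<Longrightarrow> ip d (reflect_root d a v) a = - ip d v a"
  by (simp add: reflect_root_eq ip_linear) (simp add: cartan_def)

lemma reflect_reflect: "ip d a a \<noteq> 0 \<Longrightarrow> reflect_root d a (reflect_root d a v) = v"
proof -
  assume "ip d a a \<noteq> 0"
  then have "cartan d (reflect_root d a v) a = - cartan d v a"
    by (simp add: cartan_def ip_reflect_self)
  then show ?thesis by (simp add: reflect_root_eq[of d a "reflect_root d a v"]) (simp add: reflect_root_eq)
qed

lemma reflect_orthogonal: "ip d v a = 0 \<Longrightarrow> reflect_root d a v = v"
  by (simp add: reflect_root_def)

lemma reflect_conj:
  "isometry d w \<Longrightarrow> reflect_root d (w a) (w v) = w (reflect_root d a v)"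
  using isometry_affine[of d w "- cartan d v a" a v]
  by (simp add: reflect_root_eq cartan_def isometry_ip)

section \<open>Products of reflections\<close>

lemma weyl_comp: "u \<in> weyl_group d B \<Longrightarrow> v \<in> weyl_group d B \<Longrightarrow> u \<circ> v \<in> weyl_group d B"
  by (induction rule: weyl_group.induct) (auto simp: comp_assoc intro: weyl_group.intros)

lemma weyl_reflect: "a \<in> B \<Longrightarrow> reflect_root d a \<in> weyl_group d B"
  using weyl_group.refl_comp[OF weyl_group.id_in] by fastforce

lemma weyl_subset:
  assumes "\<And>a. a \<in> B \<Longrightarrow> reflect_root d a \<in> weyl_group d C"
  shows "weyl_group d B \<subseteq> weyl_group d C"
proof
  fix w assume "w \<in> weyl_group d B"
  then show "w \<in> weyl_group d C"
    by induction (blast intro: weyl_group.id_in weyl_comp assms)+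
qed

lemma weyl_fixes: "w \<in> weyl_group d B \<Longrightarrow> (\<And>a. a \<in> B \<Longrightarrow> ip d v a = 0) \<Longrightarrow> w v = v"
  by (induction rule: weyl_group.induct) (auto simp: reflect_orthogonal)

section \<open>Crystallographic root systems and their reflection groups\<close>

locale root_system =
  fixes d :: nat and \<Phi> :: "(nat \<Rightarrow> real) set"
  assumes root_system: "crystallographic_root_system d \<Phi>"
begin

lemma finite_roots: "finite \<Phi>"
  using root_system by (simp add: crystallographic_root_system_def)

lemma root_evec: "\<Phi> \<subseteq> evec d"
  using root_system by (simp add: crystallographic_root_system_def)

lemma root_nonzero: "(\<lambda>i. 0) \<notin> \<Phi>"
  using root_system by (simp add: crystallographic_root_system_def)

lemma root_ip_pos: "a \<in> \<Phi> \<Longrightarrow> 0 < ip d a a"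
  using ip_self_eq_0[of a d] root_evec root_nonzero by fastforce

lemma root_ip_nz: "a \<in> \<Phi> \<Longrightarrow> ip d a a \<noteq> 0"
  using root_ip_pos by fastforce

lemma cartan_int: "a \<in> \<Phi> \<Longrightarrow> b \<in> \<Phi> \<Longrightarrow> cartan d b a \<in> \<int>"
  using root_system by (simp add: crystallographic_root_system_def cartan_def)

lemma reflect_in: "a \<in> \<Phi> \<Longrightarrow> b \<in> \<Phi> \<Longrightarrow> reflect_root d a b \<in> \<Phi>"
  using root_system unfolding crystallographic_root_system_def by blast

lemma root_multiple: "a \<in> \<Phi> \<Longrightarrow> (\<lambda>i. c * a i) \<in> \<Phi> \<Longrightarrow> c = 1 \<or> c = -1"
  using root_system unfolding crystallographic_root_system_def by blast

lemma uminus_in: "a \<in> \<Phi> \<Longrightarrow> (\<lambda>i. - a i) \<in> \<Phi>"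
  using reflect_in[of a a] reflect_self[OF root_ip_nz] by simp

text \<open>Both Cartan integers of the pair are positive. If one of them is 1, the difference is a
  reflected root up to sign; if both are at least 2, the squared length of g - a is at most
  0.\<close>

lemma diff_in:
  assumes "g \<in> \<Phi>" "a \<in> \<Phi>" "0 < ip d g a" "g \<noteq> a"
  shows "(\<lambda>i. g i - a i) \<in> \<Phi>"
proof -
  obtain n m where n: "cartan d g a = of_int n" and m: "cartan d a g = of_int m"
    using cartan_int assms by (metis Ints_cases)
  have pos: "0 < ip d g g" "0 < ip d a a" using root_ip_pos assms by auto
  have "0 < cartan d g a" "0 < cartan d a g"
    using pos assms(3) by (simp_all add: cartan_def ip_commute[of d a g])
  then have nm: "1 \<le> n" "1 \<le> m" unfolding n m by auto
  consider "n = 1" | "m = 1" | "2 \<le> n" "2 \<le> m" using nm by linarith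
  then show ?thesis
  proof cases
    case 1
    then show ?thesis using reflect_in[OF assms(2,1)] n by (simp add: reflect_root_eq)
  next
    case 2
    then show ?thesis using uminus_in[OF reflect_in[OF assms(1,2)]] m by (simp add: reflect_root_eq)
  next
    case 3
    then have "2 \<le> cartan d g a" "2 \<le> cartan d a g" unfolding n m by auto
    then have "ip d a a \<le> ip d g a" "ip d g g \<le> ip d g a"
      using pos by (simp_all add: cartan_def ip_commute[of d a g] field_simps)
    then have "ip d (\<lambda>i. g i - a i) (\<lambda>i. g i - a i) \<le> 0"
      by (simp add: ip_linear ip_commute[of d a g])
    moreover have "(\<lambda>i. g i - a i) \<in> evec d"
      using subsetD[OF root_evec assms(1)] subsetD[OF root_evec assms(2)] by (simp add: evec_def)
    ultimately have "(\<lambda>i. g i - a i) = (\<lambda>i. 0)" using ip_self_eq_0 by blast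
    then have "g = a" by (metis (no_types, lifting) eq_iff_diff_eq_0 ext)
    then show ?thesis using assms by blast
  qed
qed

lemma add_in:
  assumes "g \<in> \<Phi>" "a \<in> \<Phi>" "ip d g a < 0" "g \<noteq> (\<lambda>i. - a i)"
  shows "(\<lambda>i. g i + a i) \<in> \<Phi>"
  using diff_in[OF assms(1) uminus_in[OF assms(2)]] assms(3,4) by (simp add: ip_linear)

context
  fixes B assumes B: "B \<subseteq> \<Phi>"
begin

lemma finite_base: "finite B"
  using B finite_roots finite_subset by blast

lemma weyl_isometry: "w \<in> weyl_group d B \<Longrightarrow> isometry d w"
  by (induction rule: weyl_group.induct)
    (use B root_ip_nz in \<open>blast intro: isometry_id isometry_comp isometry_reflect\<close>)+

lemma weyl_root: "w \<in> weyl_group d B \<Longrightarrow> g \<in> \<Phi> \<Longrightarrow> w g \<in> \<Phi>"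
  by (induction rule: weyl_group.induct) (use B in \<open>auto intro: reflect_in\<close>)

text \<open>\<open>weyl_group\<close> is generated as a monoid; inverses arise by reversing words in
  the involutive reflections.\<close>

lemma weyl_inverse:
  assumes "w \<in> weyl_group d B"
  obtains u where "u \<in> weyl_group d B" "\<And>v. u (w v) = v" "\<And>v. w (u v) = v"
proof -
  have "\<exists>u\<in>weyl_group d B. (\<forall>v. u (w v) = v) \<and> (\<forall>v. w (u v) = v)"
    using assms
  proof induction
    case id_in
    then show ?case by (intro bexI[of _ id] weyl_group.id_in) auto
  next
    case (refl_comp w a)
    then obtain u where u: "u \<in> weyl_group d B" "\<forall>v. u (w v) = v" "\<forall>v. w (u v) = v" by blast
    have "ip d a a \<noteq> 0" using refl_comp B root_ip_nz by blast
    then show ?case using u refl_comp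
      by (intro bexI[of _ "u \<circ> reflect_root d a"] weyl_comp weyl_reflect) (auto simp: reflect_reflect)
  qed
  then show ?thesis using that by blast
qed

lemma weyl_displacement: "w \<in> weyl_group d B \<Longrightarrow> \<exists>c. w v = (\<lambda>i. v i + lin_comb B c i)"
proof (induction rule: weyl_group.induct)
  case id_in
  show ?case by (rule exI[of _ "\<lambda>_. 0"]) (simp add: lin_comb_def)
next
  case (refl_comp w a)
  then obtain c where c: "w v = (\<lambda>i. v i + lin_comb B c i)" by blast
  have "(\<lambda>i. cartan d (w v) a * a i) = lin_comb B (\<lambda>b. if b = a then cartan d (w v) a else 0)"
    using lin_comb_single[OF finite_base refl_comp(2)] by simp
  then show ?case
    by (intro exI[of _ "\<lambda>b. c b - (if b = a then cartan d (w v) a else 0)"])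
      (simp add: reflect_root_eq lin_comb_diff[symmetric] fun_eq_iff c)
qed

text \<open>Group elements are functions on all vectors, so agreement on roots has to be extended.
  The difference w v - w' v is a combination of the base, and it is orthogonal to every root because
  both maps are isometries that agree on the roots; hence it is 0.\<close>

lemma weyl_ext:
  assumes w: "w \<in> weyl_group d B" "w' \<in> weyl_group d B" and eq: "\<And>g. g \<in> \<Phi> \<Longrightarrow> w g = w' g"
  shows "w = w'"
proof
  fix v
  obtain c where c: "w v = (\<lambda>i. v i + lin_comb B c i)" using weyl_displacement w by blast
  obtain e where e: "w' v = (\<lambda>i. v i + lin_comb B e i)" using weyl_displacement w by blast
  define x where "x = lin_comb B (\<lambda>a. c a - e a)"
  have x: "x = (\<lambda>i. w v i - w' v i)" by (simp add: x_def c e flip: lin_comb_diff)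
  have "ip d b x = 0" if b: "b \<in> \<Phi>" for b
  proof -
    obtain u where u: "u \<in> weyl_group d B" "\<And>v. w (u v) = v" using weyl_inverse w(1) by metis
    have g: "u b \<in> \<Phi>" using weyl_root u b by blast
    have "ip d b x = ip d (w (u b)) (w v) - ip d (w' (u b)) (w' v)"
      using eq[OF g] u by (simp add: x ip_linear)
    then show ?thesis using weyl_isometry w by (simp add: isometry_ip)
  qed
  then have "ip d x x = 0" using B by (subst x_def) (auto simp: ip_lin_comb intro!: sum.neutral)
  moreover have "x \<in> evec d" unfolding x_def using B root_evec by (intro lin_comb_in_evec) auto
  ultimately have "x = (\<lambda>i. 0)" using ip_self_eq_0 by force
  then show "w v = w' v" using x by (metis (no_types, lifting) eq_iff_diff_eq_0 ext)
qed

lemma finite_weyl: "finite (weyl_group d B)"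
proof (rule inj_on_finite[of "\<lambda>w. restrict w \<Phi>"])
  show "inj_on (\<lambda>w. restrict w \<Phi>) (weyl_group d B)"
    by (rule inj_onI) (metis weyl_ext restrict_apply')
  show "(\<lambda>w. restrict w \<Phi>) ` weyl_group d B \<subseteq> \<Phi> \<rightarrow>\<^sub>E \<Phi>" using weyl_root by auto
  show "finite (\<Phi> \<rightarrow>\<^sub>E \<Phi>)" using finite_roots by (rule finite_PiE) (use finite_roots in auto)
qed

lemma weyl_nonempty: "weyl_group d B \<noteq> {}"
  using weyl_group.id_in by blast

lemma sum_weyl_left:
  assumes "u \<in> weyl_group d B"
  shows "(\<Sum>v\<in>weyl_group d B. F (u \<circ> v)) = (\<Sum>v\<in>weyl_group d B. F v)"
proof -
  obtain u' where u': "u' \<in> weyl_group d B" "\<And>v. u' (u v) = v" "\<And>v. u (u' v) = v"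
    using weyl_inverse assms by metis
  then have c: "u' \<circ> u = id" "u \<circ> u' = id" by auto
  show ?thesis
    by (rule sum.reindex_bij_witness[where i="\<lambda>v. u' \<circ> v" and j="\<lambda>v. u \<circ> v"])
      (simp_all add: weyl_comp assms u'(1) c flip: comp_assoc)
qed

lemma sum_weyl_right:
  assumes "u \<in> weyl_group d B"
  shows "(\<Sum>v\<in>weyl_group d B. F (v \<circ> u)) = (\<Sum>v\<in>weyl_group d B. F v)"
proof -
  obtain u' where u': "u' \<in> weyl_group d B" "\<And>v. u' (u v) = v" "\<And>v. u (u' v) = v"
    using weyl_inverse assms by metis
  then have c: "u' \<circ> u = id" "u \<circ> u' = id" by auto
  show ?thesis
    by (rule sum.reindex_bij_witness[where i="\<lambda>v. v \<circ> u'" and j="\<lambda>v. v \<circ> u"])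
      (simp_all add: weyl_comp assms u'(1) c comp_assoc)
qed

end

end

section \<open>Simple systems\<close>

lemma neg_vec_image_iff: "g \<in> neg_vec ` S \<longleftrightarrow> (\<lambda>i. - g i) \<in> S"
proof
  assume "(\<lambda>i. - g i) \<in> S"
  then show "g \<in> neg_vec ` S" by (intro image_eqI[of _ _ "\<lambda>i. - g i"]) (auto simp: neg_vec_def)
qed (auto simp: neg_vec_def)

text \<open>\<open>pos\<close> consists of the roots that are nonnegative integer combinations of
  \<open>B\<close>; a root outside the integer span of \<open>B\<close> has no sign. One-signedness
  and pointedness are the form in which the conditions can be checked for subsets of an
  antichain.\<close>

locale simple_base = root_system +
  fixes B :: "(nat \<Rightarrow> real) set"
  assumes base_roots: "B \<subseteq> \<Phi>"
    and same_sign: "\<And>c :: _ \<Rightarrow> int. lin_comb B (\<lambda>a. of_int (c a)) \<in> \<Phi> \<Longrightarrow>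
      (\<forall>b\<in>B. 0 \<le> c b) \<or> (\<forall>b\<in>B. c b \<le> 0)"
    and pointed: "\<And>c. (\<forall>b\<in>B. 0 \<le> c b) \<Longrightarrow> lin_comb B c = (\<lambda>i. 0) \<Longrightarrow> \<forall>b\<in>B. c b = 0"
begin

abbreviation "pos \<equiv> positive_roots \<Phi> B"
abbreviation "WB \<equiv> weyl_group d B"

lemmas fin = finite_base[OF base_roots]

lemma base_ip_pos: "b \<in> B \<Longrightarrow> 0 < ip d b b"
  using base_roots root_ip_pos by blast

lemma base_ip_nz: "b \<in> B \<Longrightarrow> ip d b b \<noteq> 0"
  using base_ip_pos by fastforce

lemma pos_root: "g \<in> pos \<Longrightarrow> g \<in> \<Phi>"
  by (simp add: positive_roots_def)

lemma posI:
  assumes "lin_comb B (\<lambda>a. of_int (c a)) \<in> \<Phi>" "\<And>b. b \<in> B \<Longrightarrow> 0 \<le> c b"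
  shows "lin_comb B (\<lambda>a. of_int (c a)) \<in> pos"
proof -
  have "lin_comb B (\<lambda>a. of_int (c a)) = lin_comb B (\<lambda>a. real (nat (c a)))"
    using assms(2) by (intro lin_comb_cong) auto
  then show ?thesis
    using assms(1) unfolding positive_roots_def by (auto intro: exI[of _ "\<lambda>a. nat (c a)"])
qed

lemma posI_coeff:
  assumes "lin_comb B (\<lambda>a. of_int (c a)) \<in> \<Phi>" "b \<in> B" "0 < c b"
  shows "lin_comb B (\<lambda>a. of_int (c a)) \<in> pos"
  using same_sign[OF assms(1)] assms by (intro posI) force+

lemma posE:
  assumes "g \<in> pos"
  obtains k :: "_ \<Rightarrow> nat" where "g = lin_comb B (\<lambda>a. of_int (int (k a)))"
  using assms by (auto simp: positive_roots_def)

lemma pos_or_neg: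
  assumes "lin_comb B (\<lambda>a. of_int (c a)) \<in> \<Phi>"
  shows "lin_comb B (\<lambda>a. of_int (c a)) \<in> pos \<or> (\<lambda>i. - lin_comb B (\<lambda>a. of_int (c a)) i) \<in> pos"
  using same_sign[OF assms]
proof
  assume "\<forall>b\<in>B. c b \<le> 0"
  then have "lin_comb B (\<lambda>a. of_int (- c a)) \<in> pos"
    using uminus_in[OF assms] by (intro posI) (auto simp: lin_comb_uminus)
  then show ?thesis by (simp add: lin_comb_uminus)
qed (use posI assms in auto)

lemma base_comb: "b \<in> B \<Longrightarrow> lin_comb B (\<lambda>a. of_int (if a = b then 1 else 0)) = b"
  using lin_comb_single[OF fin, of b 1] by (simp add: if_distrib[of of_int] cong: if_cong)

lemma base_pos: "B \<subseteq> pos"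
proof
  fix b assume b: "b \<in> B"
  then show "b \<in> pos" using posI[of "\<lambda>a. if a = b then 1 else 0"] base_roots base_comb[OF b] by auto
qed

lemma reflect_comb:
  assumes "b \<in> B" "cartan d (lin_comb B (\<lambda>a. of_int (c a))) b = of_int n"
  shows "reflect_root d b (lin_comb B (\<lambda>a. of_int (c a)))
    = lin_comb B (\<lambda>a. of_int (c a - (if a = b then n else 0)))"
proof -
  have "(\<lambda>i. of_int n * b i) = lin_comb B (\<lambda>a. of_int (if a = b then n else 0))"
    using lin_comb_single[OF fin assms(1), of "of_int n"] by (simp add: if_distrib[of of_int] cong: if_cong)
  then show ?thesis unfolding reflect_root_eq assms(2) by (simp add: fun_eq_iff flip: lin_comb_diff)
qed

lemma uminus_notin_pos: "g \<in> pos \<Longrightarrow> (\<lambda>i. - g i) \<notin> pos"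
proof
  assume g: "g \<in> pos" "(\<lambda>i. - g i) \<in> pos"
  obtain k where k: "g = lin_comb B (\<lambda>a. of_int (int (k a)))" using posE[OF g(1)] by metis
  obtain l where l: "(\<lambda>i. - g i) = lin_comb B (\<lambda>a. of_int (int (l a)))" using posE[OF g(2)] by metis
  have "lin_comb B (\<lambda>a. real (k a) + real (l a)) = (\<lambda>i. g i + - g i)"
    using k l by (simp add: fun_eq_iff flip: lin_comb_add)
  then have "\<forall>b\<in>B. real (k b) + real (l b) = 0" by (intro pointed) auto
  then have "\<forall>b\<in>B. k b = 0" by auto
  then have "g = (\<lambda>i. 0)" by (simp add: k lin_comb_def)
  then show False using \<open>g \<in> pos\<close> pos_root root_nonzero by blast
qed

text \<open>A positive root supported on b alone is a multiple of b, hence b, because the root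
  system is reduced.\<close>

lemma pos_coeff_ne:
  assumes "b \<in> B" "g \<in> pos" "g \<noteq> b" "g = lin_comb B (\<lambda>a. of_int (int (k a)))"
  obtains a where "a \<in> B" "a \<noteq> b" "0 < k a"
proof (rule ccontr)
  assume "\<not> thesis"
  then have "\<forall>a\<in>B. a \<noteq> b \<longrightarrow> k a = 0" using that by auto
  then have "g = lin_comb B (\<lambda>a. if a = b then real (k b) else 0)"
    unfolding assms(4) by (intro lin_comb_cong) auto
  then have g: "g = (\<lambda>i. real (k b) * b i)" using lin_comb_single[OF fin assms(1)] by simp
  have "real (k b) = 1 \<or> real (k b) = -1"
    by (rule root_multiple[of b]) (use assms base_roots pos_root g in auto)
  then have "k b = 1" by auto
  then show False using g assms(3) by simp
qed

text \<open>The reflection changes only the coefficient of b; a positive coefficient elsewhere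
  survives and decides the sign of the image.\<close>

lemma reflect_pos:
  assumes "b \<in> B" "g \<in> pos" "g \<noteq> b"
  shows "reflect_root d b g \<in> pos - {b}"
proof -
  obtain k where k: "g = lin_comb B (\<lambda>a. of_int (int (k a)))" using posE assms by metis
  obtain n where n: "cartan d g b = of_int n"
    using cartan_int[of b g] assms base_roots pos_root by (metis Ints_cases subsetD)
  obtain a where a: "a \<in> B" "a \<noteq> b" "0 < k a" using pos_coeff_ne assms k by metis
  have "reflect_root d b g \<in> \<Phi>" using reflect_in assms base_roots pos_root by blast
  moreover have "reflect_root d b g = lin_comb B (\<lambda>a. of_int (int (k a) - (if a = b then n else 0)))"
    using n unfolding k by (rule reflect_comb[OF assms(1)])
  ultimately have "reflect_root d b g \<in> pos"
    using posI_coeff[of "\<lambda>a. int (k a) - (if a = b then n else 0)" a] a by simp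
  moreover have "reflect_root d b g \<noteq> b"
  proof
    assume "reflect_root d b g = b"
    then have "g = (\<lambda>i. - b i)"
      using reflect_reflect[OF base_ip_nz[OF assms(1)], of g] reflect_self[OF base_ip_nz[OF assms(1)]] by simp
    then show False using uminus_notin_pos assms base_pos by blast
  qed
  ultimately show ?thesis by blast
qed

lemma bij_reflect_pos: "b \<in> B \<Longrightarrow> bij_betw (reflect_root d b) (pos - {b}) (pos - {b})"
  by (rule bij_betw_byWitness[where f'="reflect_root d b"])
    (use reflect_pos base_ip_nz in \<open>auto simp: reflect_reflect\<close>)

lemma finite_pos: "finite pos"
  using finite_roots by (simp add: positive_roots_def)

text \<open>Twice the usual Weyl vector, which is half the sum of the positive roots.\<close>

definition rho :: "nat \<Rightarrow> real" where
  "rho = (\<lambda>i. \<Sum>g\<in>pos. g i)"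

text \<open>The reflection in \<open>b\<close> permutes the positive roots other than \<open>b\<close>, so that their
  inner products with \<open>b\<close> cancel.\<close>
lemma ip_rho_base: "b \<in> B \<Longrightarrow> ip d rho b = ip d b b"
proof -
  assume b: "b \<in> B"
  have "(\<Sum>g\<in>pos - {b}. ip d g b) = (\<Sum>g\<in>pos - {b}. ip d (reflect_root d b g) b)"
    using sum.reindex_bij_betw[OF bij_reflect_pos[OF b], of "\<lambda>g. ip d g b"] by simp
  also have "\<dots> = - (\<Sum>g\<in>pos - {b}. ip d g b)"
    by (simp add: ip_reflect_self[OF base_ip_nz[OF b]] sum_negf)
  finally have "(\<Sum>g\<in>pos - {b}. ip d g b) = 0" by simp
  moreover have "ip d rho b = (\<Sum>g\<in>pos. ip d g b)" by (simp add: rho_def ip_sum_left)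
  ultimately show ?thesis
    using b base_pos by (simp add: sum.remove[OF finite_pos, of b] subset_iff)
qed

lemma ip_rho_pos:
  assumes "g \<in> pos" shows "0 < ip d rho g"
proof -
  obtain k where k: "g = lin_comb B (\<lambda>a. of_int (int (k a)))" using posE assms by metis
  have nn: "0 \<le> real (k a) * ip d rho a" if "a \<in> B" for a
    using ip_rho_base[OF that] base_ip_pos[OF that] by simp
  have "ip d rho g = (\<Sum>a\<in>B. real (k a) * ip d rho a)" by (simp add: k ip_lin_comb_right)
  moreover have "(\<Sum>a\<in>B. real (k a) * ip d rho a) \<noteq> 0"
  proof
    assume "(\<Sum>a\<in>B. real (k a) * ip d rho a) = 0"
    then have "\<forall>a\<in>B. real (k a) * ip d rho a = 0" using nn fin by (simp add: sum_nonneg_eq_0_iff)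
    then have "\<forall>a\<in>B. k a = 0" using ip_rho_base base_ip_pos by fastforce
    then have "g = (\<lambda>i. 0)" by (simp add: k lin_comb_def)
    then show False using assms pos_root root_nonzero by blast
  qed
  moreover have "0 \<le> (\<Sum>a\<in>B. real (k a) * ip d rho a)" using nn by (intro sum_nonneg) auto
  ultimately show ?thesis by linarith
qed

text \<open>Replacing \<open>u\<close> by \<open>u \<circ> s\<^sub>b\<close> for a simple root \<open>b\<close> with \<open>L (u b) > 0\<close> enlarges the set of
  positive roots on which \<open>L \<circ> u\<close> is negative.\<close>
lemma weyl_make_negative:
  assumes L: "linear_functional L" and nz: "\<And>g. g \<in> \<Phi> \<Longrightarrow> L g \<noteq> 0"
  obtains u where "u \<in> WB" "\<And>g. g \<in> pos \<Longrightarrow> L (u g) < 0"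
proof -
  define N where "N = (\<lambda>u. {g \<in> pos. L (u g) < 0})"
  have finN: "finite (N u)" for u using finite_pos by (simp add: N_def)
  have "\<exists>u\<in>WB. \<forall>v\<in>WB. card (N v) \<le> card (N u)"
  proof -
    have f: "finite ((\<lambda>u. card (N u)) ` WB)" using finite_weyl[OF base_roots] by simp
    have ne: "(\<lambda>u. card (N u)) ` WB \<noteq> {}" using weyl_nonempty[OF base_roots] by simp
    obtain u where "u \<in> WB" "Max ((\<lambda>u. card (N u)) ` WB) = card (N u)" using Max_in[OF f ne] by auto
    then show ?thesis using Max_ge[OF f] by (metis image_eqI)
  qed
  then obtain u where u: "u \<in> WB" "\<And>v. v \<in> WB \<Longrightarrow> card (N v) \<le> card (N u)" by blast
  have iu: "isometry d u" using weyl_isometry base_roots u by blast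
  have neg: "L (u b) < 0" if b: "b \<in> B" for b
  proof (rule ccontr)
    define v where "v = u \<circ> reflect_root d b"
    note bnz = base_ip_nz[OF b]
    assume "\<not> L (u b) < 0"
    moreover have "L (u b) \<noteq> 0" using nz weyl_root[OF base_roots u(1)] b base_roots by blast
    ultimately have Lb: "0 < L (u b)" by linarith
    have vW: "v \<in> WB" using u b by (auto simp: v_def intro: weyl_comp weyl_reflect)
    have bN: "b \<notin> N u" using Lb by (simp add: N_def)
    have "L (u (reflect_root d b b)) = - L (u b)"
      using linear_functional_sum[OF linear_functional_comp[OF L iu], of "\<lambda>_. -1" "\<lambda>_. b" "{()}"]
      by (simp add: reflect_self[OF bnz])
    then have bv: "b \<in> N v" using Lb b base_pos by (auto simp: N_def v_def)
    have "reflect_root d b ` N u \<subseteq> N v - {b}"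
    proof
      fix x assume "x \<in> reflect_root d b ` N u"
      then obtain g where g: "g \<in> N u" "x = reflect_root d b g" by blast
      then have "x \<in> pos - {b}" using reflect_pos[OF b, of g] bN by (auto simp: N_def)
      then show "x \<in> N v - {b}" using g by (simp add: N_def v_def reflect_reflect[OF bnz])
    qed
    moreover have "inj_on (reflect_root d b) (N u)"
      by (rule inj_on_inverseI[of _ "reflect_root d b"]) (simp add: reflect_reflect[OF bnz])
    ultimately have "card (N u) \<le> card (N v - {b})"
      using finN by (metis card_image card_mono finite_Diff)
    then have "card (N u) < card (N v)" using bv finN[of v] by (metis card_Diff1_less order_le_less_trans)
    then show False using u(2)[OF vW] by simp
  qed
  show ?thesis
  proof (rule that[OF u(1)])
    fix g assume g: "g \<in> pos"
    then obtain k where k: "g = lin_comb B (\<lambda>a. of_int (int (k a)))" using posE by metis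
    have "L (u g) = (\<Sum>a\<in>B. real (k a) * L (u a))"
      using linear_functional_sum[OF linear_functional_comp[OF L iu]] by (simp add: k lin_comb_def)
    also have "\<dots> \<le> 0" using neg by (intro sum_nonpos) (simp add: mult_nonneg_nonpos less_imp_le)
    finally show "L (u g) < 0" using nz[OF weyl_root[OF base_roots u(1) pos_root[OF g]]] by linarith
  qed
qed

text \<open>Integrality of the Cartan numbers keeps the orbit of the base in its integer span, where
  \<open>same_sign\<close> applies.\<close>

lemma weyl_int_comb:
  "w \<in> WB \<Longrightarrow> a \<in> B \<Longrightarrow> \<exists>c. w a = lin_comb B (\<lambda>b. of_int (c b))"
proof (induction rule: weyl_group.induct)
  case id_in
  then show ?case using base_comb[OF id_in] by (metis id_apply)
next
  case (refl_comp w b)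
  then obtain c where c: "w a = lin_comb B (\<lambda>b. of_int (c b))" by blast
  have "w a \<in> \<Phi>" using weyl_root[OF base_roots] refl_comp base_roots by blast
  then obtain n where "cartan d (w a) b = of_int n"
    using cartan_int[of b "w a"] refl_comp base_roots by (metis Ints_cases subsetD)
  then have "(reflect_root d b \<circ> w) a = lin_comb B (\<lambda>x. of_int (c x - (if x = b then n else 0)))"
    unfolding comp_apply c by (rule reflect_comb[OF refl_comp(2)])
  then show ?case by (intro exI)
qed

lemma weyl_pos_or_neg:
  assumes "w \<in> WB" "a \<in> B" shows "w a \<in> pos \<or> (\<lambda>i. - w a i) \<in> pos"
proof -
  obtain c where "w a = lin_comb B (\<lambda>b. of_int (c b))" using weyl_int_comb assms by blast
  moreover have "w a \<in> \<Phi>" using weyl_root[OF base_roots] assms base_roots by blast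
  ultimately show ?thesis using pos_or_neg by simp
qed

text \<open>Induction on the height. Since \<open>ip d g g\<close> > 0, some b occurring in g has
  \<open>ip d g b\<close> > 0; reflecting in b gives h of smaller height, and s_g = s_b s_h s_b. For
  the simple roots this puts the reflection group of an antichain inside the Weyl group.\<close>

lemma reflect_pos_in_weyl: "g \<in> pos \<Longrightarrow> reflect_root d g \<in> WB"
proof -
  have "lin_comb B (\<lambda>a. of_int (int (k a))) \<in> pos \<Longrightarrow> reflect_root d (lin_comb B (\<lambda>a. of_int (int (k a)))) \<in> WB"
    for k :: "_ \<Rightarrow> nat"
  proof (induction "\<Sum>a\<in>B. k a" arbitrary: k rule: less_induct)
    case less
    define g where "g = lin_comb B (\<lambda>a. of_int (int (k a)))"
    have g: "g \<in> pos" using less g_def by simp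
    have "ip d g g = (\<Sum>a\<in>B. real (k a) * ip d a g)" by (subst (1) g_def) (simp add: ip_lin_comb)
    moreover have "0 < ip d g g" using g pos_root root_ip_pos by blast
    ultimately obtain b where b: "b \<in> B" "0 < real (k b) * ip d b g"
      by (metis (no_types, lifting) not_le sum_nonpos)
    then have b': "0 < k b" "0 < ip d g b" by (auto simp: zero_less_mult_iff ip_commute[of d g])
    show ?case
    proof (cases "g = b")
      case True
      then show ?thesis using weyl_reflect b g_def by simp
    next
      case False
      define h where "h = reflect_root d b g"
      have h: "h \<in> pos" using reflect_pos[OF b(1) g False] by (simp add: h_def)
      obtain n where n: "cartan d g b = of_int n"
        using cartan_int[of b g] b base_roots g pos_root by (metis Ints_cases subsetD)
      have "0 < cartan d g b" using b' base_ip_pos[OF b(1)] by (simp add: cartan_def)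
      then have n0: "0 < n" using n by simp
      have hc: "h = lin_comb B (\<lambda>a. of_int (int (k a) - (if a = b then n else 0)))"
        using n unfolding h_def g_def by (rule reflect_comb[OF b(1)])
      obtain a where "a \<in> B" "a \<noteq> b" "0 < k a" using pos_coeff_ne[OF b(1) g False g_def] by metis
      \<comment> \<open>A positive coefficient away from b is unchanged, so no coefficient of h is
        negative and \<open>nat\<close> below loses nothing.\<close>
      then have nn: "\<forall>x\<in>B. 0 \<le> int (k x) - (if x = b then n else 0)"
        using same_sign[of "\<lambda>a. int (k a) - (if a = b then n else 0)"] hc pos_root[OF h] by force
      define l where "l = (\<lambda>x. nat (int (k x) - (if x = b then n else 0)))"
      have hl: "h = lin_comb B (\<lambda>a. of_int (int (l a)))"
        unfolding hc l_def using nn by (intro lin_comb_cong) auto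
      have "(\<Sum>a\<in>B. l a) < (\<Sum>a\<in>B. k a)"
      proof (rule sum_strict_mono_ex1[OF fin])
        show "\<forall>a\<in>B. l a \<le> k a" using n0 by (auto simp: l_def)
        show "\<exists>a\<in>B. l a < k a" using b(1) b'(1) n0 by (intro bexI[of _ b]) (auto simp: l_def)
      qed
      then have hW: "reflect_root d h \<in> WB" using less.hyps[of l] h hl by simp
      have "reflect_root d g v = reflect_root d b (reflect_root d h (reflect_root d b v))" for v
      proof -
        note r = reflect_reflect[OF base_ip_nz[OF b(1)]]
        note i = isometry_reflect[OF base_ip_nz[OF b(1)]]
        have "reflect_root d b (reflect_root d h (reflect_root d b v))
          = reflect_root d b (reflect_root d b (reflect_root d g v))"
          unfolding h_def reflect_conj[OF i] ..
        then show ?thesis by (simp add: r)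
      qed
      then have "reflect_root d g = reflect_root d b \<circ> (reflect_root d h \<circ> reflect_root d b)" by auto
      then show ?thesis unfolding g_def[symmetric]
        using b hW by (auto intro!: weyl_comp weyl_reflect simp del: o_apply)
    qed
  qed
  moreover assume "g \<in> pos"
  ultimately show ?thesis using posE by metis
qed

end

section \<open>Antichains are simple systems\<close>

locale antichain_system = root_system +
  fixes \<Delta> \<Psi> :: "(nat \<Rightarrow> real) set"
  assumes simple: "simple_system d \<Phi> \<Delta>" and antichain: "root_antichain \<Phi> \<Delta> \<Psi>"
begin

sublocale simple: simple_base d \<Phi> \<Delta>
proof
  show sub: "\<Delta> \<subseteq> \<Phi>" using simple by (simp add: simple_system_def)
  have ind: "\<forall>a\<in>\<Delta>. c a = 0" if "lin_comb \<Delta> c = (\<lambda>i. 0)" for c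
    using simple that by (simp add: simple_system_def)
  show "(\<forall>b\<in>\<Delta>. 0 \<le> c b) \<or> (\<forall>b\<in>\<Delta>. c b \<le> 0)"
    if r: "lin_comb \<Delta> (\<lambda>a. of_int (c a)) \<in> \<Phi>" for c :: "_ \<Rightarrow> int"
  proof -
    have u: "\<forall>a\<in>\<Delta>. of_int (c a) = e a" if "lin_comb \<Delta> (\<lambda>a. of_int (c a)) = lin_comb \<Delta> e" for e
      using ind[of "\<lambda>a. of_int (c a) - e a"] that by (simp flip: lin_comb_diff)
    obtain k :: "_ \<Rightarrow> nat" where "lin_comb \<Delta> (\<lambda>a. of_int (c a)) = lin_comb \<Delta> (\<lambda>a. real (k a))
        \<or> lin_comb \<Delta> (\<lambda>a. of_int (c a)) = lin_comb \<Delta> (\<lambda>a. - real (k a))"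
      using simple r unfolding simple_system_def by meson
    then show ?thesis
    proof
      assume "lin_comb \<Delta> (\<lambda>a. of_int (c a)) = lin_comb \<Delta> (\<lambda>a. real (k a))"
      then have "\<forall>a\<in>\<Delta>. real_of_int (c a) = real (k a)" by (rule u)
      then have "\<forall>a\<in>\<Delta>. 0 \<le> real_of_int (c a)" by simp
      then show ?thesis by simp
    next
      assume "lin_comb \<Delta> (\<lambda>a. of_int (c a)) = lin_comb \<Delta> (\<lambda>a. - real (k a))"
      then have "\<forall>a\<in>\<Delta>. real_of_int (c a) = - real (k a)" by (rule u)
      then have "\<forall>a\<in>\<Delta>. real_of_int (c a) \<le> 0" by simp
      then show ?thesis by simp
    qed
  qed
  show "\<And>c. \<forall>b\<in>\<Delta>. 0 \<le> c b \<Longrightarrow> lin_comb \<Delta> c = (\<lambda>i. 0) \<Longrightarrow> \<forall>b\<in>\<Delta>. c b = 0" using ind by blast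
qed

abbreviation "W \<equiv> weyl_group d \<Delta>"
abbreviation "\<rho> \<equiv> simple.rho"

lemma antichain_pos: "\<Psi> \<subseteq> positive_roots \<Phi> \<Delta>"
  using antichain by (simp add: root_antichain_def)

lemma antichain_roots: "\<Psi> \<subseteq> \<Phi>"
  using antichain_pos simple.pos_root by blast

lemma finite_antichain: "finite \<Psi>"
  using antichain_roots finite_roots finite_subset by blast

lemma ip_rho_antichain: "a \<in> \<Psi> \<Longrightarrow> 0 < ip d \<rho> a"
  using antichain_pos simple.ip_rho_pos by blast

text \<open>Positivity becomes the sign of one linear functional, the form in which
  \<open>weyl_make_negative\<close> is applied.\<close>

lemma pos_iff: "g \<in> \<Phi> \<Longrightarrow> g \<in> positive_roots \<Phi> \<Delta> \<longleftrightarrow> 0 < ip d \<rho> g"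
proof
  assume g: "g \<in> \<Phi>" "0 < ip d \<rho> g"
  obtain k :: "_ \<Rightarrow> nat" where "g = lin_comb \<Delta> (\<lambda>a. real (k a)) \<or> g = lin_comb \<Delta> (\<lambda>a. - real (k a))"
    using simple g unfolding simple_system_def by meson
  then show "g \<in> positive_roots \<Phi> \<Delta>"
  proof
    assume k: "g = lin_comb \<Delta> (\<lambda>a. - real (k a))"
    have "ip d \<rho> g \<le> 0"
      unfolding k ip_lin_comb_right
      using simple.ip_rho_base simple.base_ip_pos by (intro sum_nonpos) (simp add: less_imp_le)
    then show ?thesis using g by simp
  qed (use g in \<open>auto simp: positive_roots_def\<close>)
qed (rule simple.ip_rho_pos)

lemma neg_iff: "g \<in> \<Phi> \<Longrightarrow> g \<in> neg_vec ` positive_roots \<Phi> \<Delta> \<longleftrightarrow> ip d \<rho> g < 0"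
  by (simp add: neg_vec_image_iff pos_iff uminus_in ip_minus_right)

lemma ip_rho_nz: "g \<in> \<Phi> \<Longrightarrow> ip d \<rho> g \<noteq> 0"
proof -
  assume g: "g \<in> \<Phi>"
  obtain k :: "_ \<Rightarrow> nat" where "g = lin_comb \<Delta> (\<lambda>a. real (k a)) \<or> g = lin_comb \<Delta> (\<lambda>a. - real (k a))"
    using simple g unfolding simple_system_def by meson
  then have "g \<in> positive_roots \<Phi> \<Delta> \<or> (\<lambda>i. - g i) \<in> positive_roots \<Phi> \<Delta>"
    using g uminus_in[OF g] by (auto simp: positive_roots_def lin_comb_uminus)
  then show ?thesis using simple.ip_rho_pos by (fastforce simp: ip_minus_right)
qed

text \<open>The order is generated by covers, so a nonnegative difference g has to be realized by a
  chain. Some simple x in g has \<open>ip d g x\<close> > 0; then the upper root has a positive or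
  the lower root a negative product with x, and the chain can descend from the former or ascend from
  the latter by x.\<close>

lemma root_le_if_sum:
  assumes "b \<in> positive_roots \<Phi> \<Delta>" "(\<lambda>i. b i + lin_comb \<Delta> (\<lambda>x. real (k x)) i) \<in> positive_roots \<Phi> \<Delta>"
  shows "root_le \<Phi> \<Delta> b (\<lambda>i. b i + lin_comb \<Delta> (\<lambda>x. real (k x)) i)"
  using assms
proof (induction "\<Sum>x\<in>\<Delta>. k x" arbitrary: b k rule: less_induct)
  case less
  define g where "g = lin_comb \<Delta> (\<lambda>x. real (k x))"
  define a where "a = (\<lambda>i. b i + g i)"
  have a: "a \<in> positive_roots \<Phi> \<Delta>" using less by (simp add: a_def g_def)
  show ?case
  proof (cases "\<forall>x\<in>\<Delta>. k x = 0")
    case True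
    then have "lin_comb \<Delta> (\<lambda>x. real (k x)) = (\<lambda>i. 0)" by (simp add: lin_comb_def)
    then show ?thesis by (simp add: root_le_def)
  next
    case False
    have gnz: "g \<noteq> (\<lambda>i. 0)" using simple.pointed[of "\<lambda>x. real (k x)"] False by (auto simp: g_def)
    have gev: "g \<in> evec d" unfolding g_def using simple.base_roots root_evec by (intro lin_comb_in_evec) auto
    have "0 < ip d g g" using ip_self_eq_0[OF gev] gnz by force
    moreover have "ip d g g = (\<Sum>x\<in>\<Delta>. real (k x) * ip d x g)" by (subst (1) g_def) (simp add: ip_lin_comb)
    ultimately obtain x where x: "x \<in> \<Delta>" "0 < real (k x) * ip d x g"
      by (metis (no_types, lifting) not_le sum_nonpos)
    then have kx: "0 < k x" and xg: "0 < ip d g x" by (auto simp: zero_less_mult_iff ip_commute[of d g])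
    define l where "l = k(x := k x - 1)"
    have lsum: "(\<Sum>y\<in>\<Delta>. l y) < (\<Sum>y\<in>\<Delta>. k y)"
      using kx x(1) by (intro sum_strict_mono_ex1 simple.fin) (auto simp: l_def intro!: bexI[of _ x])
    have "lin_comb \<Delta> (\<lambda>y. if y = x then 1 else 0) = x"
      using lin_comb_single[OF simple.fin x(1), of 1] by simp
    moreover have "lin_comb \<Delta> (\<lambda>y. real (l y)) = lin_comb \<Delta> (\<lambda>y. real (k y) - (if y = x then 1 else 0))"
      using kx by (intro lin_comb_cong) (auto simp: l_def)
    ultimately have gl: "lin_comb \<Delta> (\<lambda>y. real (l y)) = (\<lambda>i. g i - x i)"
      by (simp add: g_def flip: lin_comb_diff)
    have ax: "ip d a x = ip d b x + ip d g x" by (simp add: a_def ip_linear)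
    have xr: "x \<in> \<Phi>" "x \<in> positive_roots \<Phi> \<Delta>" using x simple.base_roots simple.base_pos by auto
    obtain kb where kb: "b = lin_comb \<Delta> (\<lambda>a. of_int (int (kb a)))" using simple.posE less.prems(1) by metis
    have br: "b \<in> \<Phi>" and ar: "a \<in> \<Phi>" using less.prems(1) a simple.pos_root by auto
    consider "0 < ip d a x" | "ip d b x < 0" using ax xg by linarith
    then show ?thesis
    proof cases
      case 1
      \<comment> \<open>Equality would make b plus a nonnegative combination vanish, against
        pointedness.\<close>
      have "a \<noteq> x"
      proof
        assume "a = x"
        then have ai: "b i + (g i - x i) = 0" for i using fun_cong[OF a_def, of i] by simp
        have "lin_comb \<Delta> (\<lambda>y. real (kb y) + real (l y)) = (\<lambda>i. b i + (g i - x i))"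
          unfolding lin_comb_add[symmetric] gl by (subst kb) simp
        also have "\<dots> = (\<lambda>i. 0)" using ai by blast
        finally have "\<forall>y\<in>\<Delta>. real (kb y) + real (l y) = 0" by (intro simple.pointed) auto
        then have "\<forall>y\<in>\<Delta>. kb y = 0" by auto
        then have "b = (\<lambda>i. 0)" by (simp add: kb lin_comb_def)
        then show False using br root_nonzero by blast
      qed
      then have r: "(\<lambda>i. a i - x i) \<in> \<Phi>" using diff_in ar xr 1 by blast
      have eq: "(\<lambda>i. a i - x i) = (\<lambda>i. b i + lin_comb \<Delta> (\<lambda>y. real (l y)) i)"
        by (simp add: gl a_def algebra_simps)
      also have "\<dots> = lin_comb \<Delta> (\<lambda>y. real (kb y + l y))" by (simp add: kb lin_comb_add)
      finally have p: "(\<lambda>i. a i - x i) \<in> positive_roots \<Phi> \<Delta>" 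
        using r unfolding positive_roots_def by (intro CollectI conjI exI[of _ "\<lambda>y. kb y + l y"])
      have "root_le \<Phi> \<Delta> b (\<lambda>i. b i + lin_comb \<Delta> (\<lambda>y. real (l y)) i)"
        using less.hyps[OF lsum less.prems(1)] p eq by simp
      moreover have "root_cover \<Phi> \<Delta> (\<lambda>i. a i - x i) a"
        using p a x by (simp add: root_cover_def)
      ultimately show ?thesis
        unfolding eq[symmetric] g_def[symmetric] a_def[symmetric] root_le_def by (metis rtranclp.rtrancl_into_rtrancl)
    next
      case 2
      have "b \<noteq> (\<lambda>i. - x i)" using less.prems(1) xr(2) simple.uminus_notin_pos by blast
      then have r: "(\<lambda>i. b i + x i) \<in> \<Phi>" using add_in br xr 2 by blast
      have p: "(\<lambda>i. b i + x i) \<in> positive_roots \<Phi> \<Delta>"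
        using r simple.ip_rho_pos[OF less.prems(1)] simple.ip_rho_pos[OF xr(2)]
        by (simp add: pos_iff ip_linear)
      have eq: "(\<lambda>i. (b i + x i) + lin_comb \<Delta> (\<lambda>y. real (l y)) i) = a"
        by (simp add: gl a_def algebra_simps)
      have "root_le \<Phi> \<Delta> (\<lambda>i. b i + x i) a"
        using less.hyps[OF lsum p] a eq by simp
      moreover have "root_cover \<Phi> \<Delta> b (\<lambda>i. b i + x i)"
        using p less.prems x by (simp add: root_cover_def)
      ultimately show ?thesis
        unfolding g_def[symmetric] a_def[symmetric] root_le_def by (metis converse_rtranclp_into_rtranclp)
    qed
  qed
qed

lemma antichain_diff: 
  assumes "a \<in> \<Psi>" "b \<in> \<Psi>" "a \<noteq> b" shows "(\<lambda>i. a i - b i) \<notin> \<Phi>"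
proof
  have no: False if ab: "a \<in> \<Psi>" "b \<in> \<Psi>" "a \<noteq> b" and p: "(\<lambda>i. a i - b i) \<in> positive_roots \<Phi> \<Delta>" for a b
  proof -
    obtain k :: "_ \<Rightarrow> nat" where k: "(\<lambda>i. a i - b i) = lin_comb \<Delta> (\<lambda>x. real (k x))"
      using p by (auto simp: positive_roots_def)
    have "a = (\<lambda>i. b i + lin_comb \<Delta> (\<lambda>x. real (k x)) i)" by (simp flip: k)
    then have "root_le \<Phi> \<Delta> b a" using root_le_if_sum[of b k] ab antichain_pos by auto
    then show False using antichain ab unfolding root_antichain_def by metis
  qed
  assume r: "(\<lambda>i. a i - b i) \<in> \<Phi>"
  show False
  proof (cases "0 < ip d \<rho> (\<lambda>i. a i - b i)")
    case True
    then show False using no[OF assms] r pos_iff by blast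
  next
    case False
    then have "0 < ip d \<rho> (\<lambda>i. b i - a i)" using ip_rho_nz[OF r] by (simp add: ip_linear)
    moreover have "(\<lambda>i. b i - a i) \<in> \<Phi>" using uminus_in[OF r] by simp
    ultimately show False using no[OF assms(2,1)] assms(3) pos_iff by blast
  qed
qed

lemma antichain_obtuse: "a \<in> \<Psi> \<Longrightarrow> b \<in> \<Psi> \<Longrightarrow> a \<noteq> b \<Longrightarrow> ip d a b \<le> 0"
  using diff_in[of a b] antichain_diff[of a b] antichain_roots by (meson not_le subsetD)

section \<open>Subsets of an antichain as bases\<close>

context
  fixes A assumes A: "A \<subseteq> \<Psi>"
begin

lemma finite_A: "finite A"
  using A finite_antichain finite_subset by blast

text \<open>Pairing with \<rho>: an antichain lies in an open half-space.\<close>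

lemma nonneg_comb_eq_0:
  assumes "\<forall>a\<in>A. 0 \<le> p a" "lin_comb A p = (\<lambda>i. 0)" shows "\<forall>a\<in>A. p a = 0"
proof -
  have "(\<Sum>a\<in>A. p a * ip d \<rho> a) = ip d \<rho> (lin_comb A p)" by (simp add: ip_lin_comb_right)
  also have "\<dots> = 0" by (simp add: assms(2) ip_def)
  finally have "\<forall>a\<in>A. p a * ip d \<rho> a = 0"
    using assms(1) A finite_A
    by (subst (asm) sum_nonneg_eq_0_iff) (auto intro!: mult_nonneg_nonneg order_less_imp_le[OF ip_rho_antichain])
  then show ?thesis using ip_rho_antichain A by fastforce
qed

lemma disjoint_combs_obtuse:
  assumes "\<forall>a\<in>A. 0 \<le> p a" "\<forall>a\<in>A. 0 \<le> q a" "\<forall>a\<in>A. p a * q a = 0"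
  shows "ip d (lin_comb A p) (lin_comb A q) \<le> 0"
proof -
  have "p a * (q b * ip d a b) \<le> 0" if "a \<in> A" "b \<in> A" for a b
  proof (cases "a = b")
    case True
    then show ?thesis using assms(3) that by (metis mult.assoc mult_zero_left order_refl)
  next
    case False
    then have "ip d a b \<le> 0" using antichain_obtuse A that by blast
    then have "q b * ip d a b \<le> 0" using assms(2) that by (simp add: mult_nonneg_nonpos)
    then show ?thesis using assms(1) that by (simp add: mult_nonneg_nonpos)
  qed
  moreover have "ip d (lin_comb A p) (lin_comb A q) = (\<Sum>a\<in>A. \<Sum>b\<in>A. p a * (q b * ip d a b))"
    by (subst ip_lin_comb) (simp add: ip_lin_comb_right sum_distrib_left)
  ultimately show ?thesis by (auto intro!: sum_nonpos)
qed

text \<open>The root is P - Q with disjoint supports. Obtuseness gives \<open>ip d g P\<close> \<ge>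
  \<open>ip d P P\<close> > 0, so some a in the positive support has a positive product with the
  root and can be subtracted.\<close>

lemma mixed_root_reduce:
  fixes c :: "_ \<Rightarrow> int"
  assumes r: "lin_comb A (\<lambda>a. of_int (c a)) \<in> \<Phi>" and pos: "a\<^sub>0 \<in> A" "0 < c a\<^sub>0" and neg: "b\<^sub>0 \<in> A" "c b\<^sub>0 < 0"
  obtains a where "a \<in> A" "0 < c a" "lin_comb A (\<lambda>x. of_int (c x - (if x = a then 1 else 0))) \<in> \<Phi>"
proof -
  define p where "p = (\<lambda>a. real_of_int (max (c a) 0))"
  define q where "q = (\<lambda>a. real_of_int (max (- c a) 0))"
  define P where "P = lin_comb A p"
  define Q where "Q = lin_comb A q"
  define g where "g = lin_comb A (\<lambda>a. of_int (c a))"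
  have ev: "lin_comb A f \<in> evec d" for f
    using A antichain_roots root_evec by (intro lin_comb_in_evec) blast
  have pq: "\<forall>a\<in>A. 0 \<le> p a" "\<forall>a\<in>A. 0 \<le> q a" "\<forall>a\<in>A. p a * q a = 0"
    by (auto simp: p_def q_def max_def)
  have gPQ: "g = (\<lambda>i. P i - Q i)"
    unfolding g_def P_def Q_def lin_comb_diff by (intro lin_comb_cong) (auto simp: p_def q_def max_def)
  have "P \<noteq> (\<lambda>i. 0)" using nonneg_comb_eq_0[OF pq(1)] pos by (force simp: P_def p_def)
  then have "0 < ip d P P" using ip_self_eq_0[OF ev, of p] by (force simp: P_def)
  then have "0 < ip d g P"
    using disjoint_combs_obtuse[OF pq] by (simp add: gPQ ip_linear ip_commute[of d "lin_comb A q"] P_def Q_def)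
  also have "ip d g P = (\<Sum>a\<in>A. p a * ip d g a)" by (simp add: P_def ip_lin_comb_right)
  finally obtain a where a: "a \<in> A" "0 < p a * ip d g a"
    by (metis (no_types, lifting) not_le sum_nonpos)
  then have pa: "0 < p a" and ga: "0 < ip d g a" using pq(1) by (auto simp: zero_less_mult_iff)
  then have ca: "0 < c a" by (simp add: p_def)
  have a_comb: "a = lin_comb A (\<lambda>x. if x = a then 1 else 0)"
    using lin_comb_single[OF finite_A a(1), of 1] by simp
  \<comment> \<open>If g = a then Q = P - a, which by integrality is still nonnegative with support
    disjoint from that of Q; obtuseness makes Q zero, against the negative coefficient.\<close>
  have "g \<noteq> a"
  proof
    assume "g = a"
    then have "P i - a i = Q i" for i using fun_cong[OF gPQ, of i] by simp
    then have PaQ: "(\<lambda>i. P i - a i) = Q" by blast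
    have "(\<lambda>i. P i - a i) = lin_comb A (\<lambda>x. p x - (if x = a then 1 else 0))"
      by (subst a_comb) (simp add: P_def lin_comb_diff)
    moreover have "ip d (lin_comb A (\<lambda>x. p x - (if x = a then 1 else 0))) Q \<le> 0"
      unfolding Q_def using pq ca by (intro disjoint_combs_obtuse) (auto simp: p_def q_def max_def)
    ultimately have "ip d Q Q \<le> 0" using PaQ by simp
    then have "Q = (\<lambda>i. 0)" unfolding Q_def using ip_self_eq_0[OF ev] by blast
    then show False using nonneg_comb_eq_0[OF pq(2)] neg by (force simp: Q_def q_def)
  qed
  then have "(\<lambda>i. g i - a i) \<in> \<Phi>" using diff_in r a A antichain_roots ga g_def by blast
  moreover have "(\<lambda>i. g i - a i) = lin_comb A (\<lambda>x. of_int (c x - (if x = a then 1 else 0)))"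
    by (subst a_comb) (simp add: g_def lin_comb_diff if_distrib[of of_int] cong: if_cong)
  ultimately show ?thesis using that[OF a(1) ca] by simp
qed

text \<open>By induction the root left after subtracting one element is one-signed, so the positive
  part was that element alone. The same for the negated root leaves a difference a - b, excluded by
  \<open>antichain_diff\<close>.\<close>

lemma antichain_same_sign:
  fixes c :: "_ \<Rightarrow> int"
  assumes "lin_comb A (\<lambda>a. of_int (c a)) \<in> \<Phi>"
  shows "(\<forall>b\<in>A. 0 \<le> c b) \<or> (\<forall>b\<in>A. c b \<le> 0)"
  using assms
proof (induction "\<Sum>a\<in>A. nat \<bar>c a\<bar>" arbitrary: c rule: less_induct)
  case less
  show ?case
  proof (rule ccontr)
    assume "\<not> ?thesis"
    then obtain a0 b0 where ab0: "a0 \<in> A" "0 < c a0" "b0 \<in> A" "c b0 < 0" by (meson not_le)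
    \<comment> \<open>Stated for every e with the absolute values of c, so as to serve both c and
      -c.\<close>
    have step: "e a = 1 \<and> (\<forall>x\<in>A - {a}. e x \<le> 0)"
      if e: "\<And>x. \<bar>e x\<bar> = \<bar>c x\<bar>" and n: "b \<in> A" "e b < 0" and a: "a \<in> A" "0 < e a"
        and r: "lin_comb A (\<lambda>x. of_int (e x - (if x = a then 1 else 0))) \<in> \<Phi>" for e :: "_ \<Rightarrow> int" and a b
    proof -
      have "(\<Sum>x\<in>A. nat \<bar>e x - (if x = a then 1 else 0)\<bar>) < (\<Sum>x\<in>A. nat \<bar>e x\<bar>)"
        using a by (intro sum_strict_mono_ex1 finite_A) (auto intro!: bexI[of _ a])
      then have "(\<forall>x\<in>A. 0 \<le> e x - (if x = a then 1 else 0)) \<or> (\<forall>x\<in>A. e x - (if x = a then 1 else 0) \<le> 0)"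
        using less.hyps[OF _ r] by (simp add: e)
      then show ?thesis
      proof
        assume "\<forall>x\<in>A. 0 \<le> e x - (if x = a then 1 else 0)"
        then have "0 \<le> e b - (if b = a then 1 else 0)" using n by blast
        then show ?thesis using n by (auto split: if_splits)
      next
        assume le: "\<forall>x\<in>A. e x - (if x = a then 1 else 0) \<le> 0"
        then have "e a - 1 \<le> 0" using a(1) by (metis (full_types))
        then have "e a = 1" using a(2) by linarith
        moreover have "e x \<le> 0" if "x \<in> A - {a}" for x using le[rule_format, of x] that by simp
        ultimately show ?thesis by blast
      qed
    qed
    obtain a where a: "a \<in> A" "0 < c a" "lin_comb A (\<lambda>x. of_int (c x - (if x = a then 1 else 0))) \<in> \<Phi>"
      using mixed_root_reduce[OF less.prems ab0] by metis
    have ca: "c a = 1" "\<forall>x\<in>A - {a}. c x \<le> 0" using step[OF _ ab0(3,4) a] by auto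
    define m where "m = (\<lambda>x. - c x)"
    have mr: "lin_comb A (\<lambda>x. of_int (m x)) \<in> \<Phi>"
      using uminus_in[OF less.prems] by (simp add: m_def lin_comb_uminus)
    have mm: "0 < m b0" "m a0 < 0" using ab0 by (simp_all add: m_def)
    obtain b where b: "b \<in> A" "0 < m b" "lin_comb A (\<lambda>x. of_int (m x - (if x = b then 1 else 0))) \<in> \<Phi>"
      using mixed_root_reduce[OF mr ab0(3) mm(1) ab0(1) mm(2)] by metis
    have mb: "m b = 1" "\<forall>x\<in>A - {b}. m x \<le> 0" using step[OF _ ab0(1) _ b] ab0 by (auto simp: m_def)
    have ab: "a \<noteq> b" using ca(1) mb(1) by (auto simp: m_def)
    have "c x = (if x = a then 1 else 0) - (if x = b then 1 else 0)" if "x \<in> A" for x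
      using ca mb that ab unfolding m_def by (cases "x = a"; cases "x = b") force+
    then have "lin_comb A (\<lambda>x. of_int (c x))
      = lin_comb A (\<lambda>x. (if x = a then 1 else 0) - (if x = b then 1 else 0))"
      by (intro lin_comb_cong) auto
    also have "\<dots> = (\<lambda>i. a i - b i)"
      using lin_comb_single[OF finite_A a(1), of 1] lin_comb_single[OF finite_A b(1), of 1]
      by (simp flip: lin_comb_diff)
    finally show False using less.prems antichain_diff a b ab A by (metis subsetD)
  qed
qed

lemma simple_base_subset: "simple_base d \<Phi> A"
  by unfold_locales (use A antichain_roots antichain_same_sign nonneg_comb_eq_0 in \<open>blast+\<close>)

end

end

section \<open>Sign patterns of an antichain under the Weyl group\<close>

context root_system
begin

text \<open>Every element is \<open>r ^^ k\<close> or \<open>t \<circ> r ^^ k\<close>, with k taken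
  modulo m. An upper bound on the order is what a lower bound for the probability of a sign pattern
  calls for.\<close>

lemma card_weyl_pair_le:
  assumes ab: "a \<in> \<Phi>" "b \<in> \<Phi>" and m: "0 < m"
    and id: "(reflect_root d a \<circ> reflect_root d b) ^^ m = id"
  shows "card (weyl_group d {a, b}) \<le> 2 * m"
proof -
  define s where "s = reflect_root d a"
  define t where "t = reflect_root d b"
  define r where "r = s \<circ> t"
  have ss: "s \<circ> s = id" and tt: "t \<circ> t = id"
    using reflect_reflect root_ip_nz ab by (auto simp: s_def t_def)
  have rm: "r ^^ m = id" using id by (simp add: r_def s_def t_def)
  \<comment> \<open>The relation \<open>r ^^ m = id\<close> lets \<open>r ^^ (m - 1)\<close> play
    the inverse of \<open>r\<close>, so that exponents stay natural.\<close>
  have sr: "s \<circ> r ^^ k = t \<circ> r ^^ (m - 1 + k)" for k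
  proof -
    have "s \<circ> r ^^ k = s \<circ> (r ^^ (Suc (m - 1)) \<circ> r ^^ k)" using rm m by simp
    also have "\<dots> = (s \<circ> s) \<circ> t \<circ> (r ^^ (m - 1) \<circ> r ^^ k)" by (simp add: r_def comp_assoc)
    also have "\<dots> = t \<circ> r ^^ (m - 1 + k)" by (simp add: ss funpow_add)
    finally show ?thesis .
  qed
  have "weyl_group d {a, b} \<subseteq> range (\<lambda>k. r ^^ k) \<union> range (\<lambda>k. t \<circ> r ^^ k)"
  proof
    fix w assume "w \<in> weyl_group d {a, b}"
    then show "w \<in> range (\<lambda>k. r ^^ k) \<union> range (\<lambda>k. t \<circ> r ^^ k)"
    proof induction
      case id_in
      have "id = r ^^ 0" by simp
      then show ?case by blast
    next
      case (refl_comp w c)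
      have st: "s \<circ> (t \<circ> r ^^ k) = r ^^ Suc k" for k by (simp add: r_def comp_assoc)
      have ttr: "t \<circ> (t \<circ> r ^^ k) = r ^^ k" for k by (simp add: tt flip: comp_assoc)
      have "reflect_root d c = s \<or> reflect_root d c = t" using refl_comp(2) by (auto simp: s_def t_def)
      moreover obtain k where "w = r ^^ k \<or> w = t \<circ> r ^^ k" using refl_comp(3) by blast
      ultimately consider "reflect_root d c \<circ> w = s \<circ> r ^^ k" | "reflect_root d c \<circ> w = t \<circ> r ^^ k"
        | "reflect_root d c \<circ> w = s \<circ> (t \<circ> r ^^ k)" | "reflect_root d c \<circ> w = t \<circ> (t \<circ> r ^^ k)" by blast
      then show ?case unfolding sr st ttr by cases blast+
    qed
  qed
  also have "range (\<lambda>k. r ^^ k) \<subseteq> (\<lambda>k. r ^^ k) ` {..<m}"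
  proof
    fix f assume "f \<in> range (\<lambda>k. r ^^ k)"
    then obtain k where f: "f = r ^^ k" by blast
    have "(r ^^ k) x = (r ^^ (k mod m)) x" for x using funpow_mod_eq[of m r x k] rm by simp
    then have "r ^^ k = r ^^ (k mod m)" by blast
    then show "f \<in> (\<lambda>k. r ^^ k) ` {..<m}" using f m by auto
  qed
  also have "range (\<lambda>k. t \<circ> r ^^ k) \<subseteq> (\<lambda>k. t \<circ> r ^^ k) ` {..<m}"
  proof
    fix f assume "f \<in> range (\<lambda>k. t \<circ> r ^^ k)"
    then obtain k where f: "f = t \<circ> r ^^ k" by blast
    have "(r ^^ k) x = (r ^^ (k mod m)) x" for x using funpow_mod_eq[of m r x k] rm by simp
    then have "r ^^ k = r ^^ (k mod m)" by blast
    then show "f \<in> (\<lambda>k. t \<circ> r ^^ k) ` {..<m}" using f m by auto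
  qed
  finally have "weyl_group d {a, b} \<subseteq> (\<lambda>k. r ^^ k) ` {..<m} \<union> (\<lambda>k. t \<circ> r ^^ k) ` {..<m}" by blast
  then have "card (weyl_group d {a, b}) \<le> card ((\<lambda>k. r ^^ k) ` {..<m} \<union> (\<lambda>k. t \<circ> r ^^ k) ` {..<m})"
    by (intro card_mono) auto
  also have "\<dots> \<le> card ((\<lambda>k. r ^^ k) ` {..<m}) + card ((\<lambda>k. t \<circ> r ^^ k) ` {..<m})" by (rule card_Un_le)
  also have "\<dots> \<le> m + m" by (intro add_mono order_trans[OF card_image_le]) auto
  finally show ?thesis by simp
qed

text \<open>In the coordinates p, q of v + p a + q b the rotation is an affine map given by x, y and
  the Cartan numbers of v; its m-th iterate is computed for each of the six pairs.\<close>

lemma rotation_order: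
  assumes "a \<in> \<Phi>" "b \<in> \<Phi>" "cartan d b a = - x" "cartan d a b = - y"
  and xy: "(x, y, m) \<in> {(0, 0, 2), (1, 1, 3), (1, 2, 4), (2, 1, 4), (1, 3, 6), (3, 1, 6)}"
  shows "(reflect_root d a \<circ> reflect_root d b) ^^ m = id"
proof
  fix v
  define cmb where "cmb = (\<lambda>p q. (\<lambda>i. v i + p * a i + q * b i))"
  define p0 where "p0 = cartan d v a"
  define q0 where "q0 = cartan d v b"
  define r where "r = reflect_root d a \<circ> reflect_root d b"
  have two: "cartan d c c = 2" if "c \<in> \<Phi>" for c using root_ip_nz[OF that] by (simp add: cartan_def)
  have lin: "cartan d (cmb p q) c = cartan d v c + p * cartan d a c + q * cartan d b c" for p q c
    by (simp add: cmb_def cartan_def ip_linear add_divide_distrib distrib_left) (simp add: mult_ac)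
  have a: "reflect_root d a (cmb p q) = cmb (x * q - p - p0) q" for p q
    using lin[of p q a] two[OF assms(1)] assms(3)
    by (simp add: reflect_root_eq p0_def) (simp add: cmb_def algebra_simps)
  have b: "reflect_root d b (cmb p q) = cmb p (y * p - q - q0)" for p q
    using lin[of p q b] two[OF assms(2)] assms(4)
    by (simp add: reflect_root_eq q0_def) (simp add: cmb_def algebra_simps)
  have r: "r (cmb p q) = cmb (x * (y * p - q - q0) - p - p0) (y * p - q - q0)" for p q
    by (simp add: r_def a b)
  have "(r ^^ m) (cmb 0 0) = cmb 0 0"
    using xy by (elim insertE emptyE) (simp_all add: r eval_nat_numeral algebra_simps)
  then show "((reflect_root d a \<circ> reflect_root d b) ^^ m) v = id v" by (simp add: cmb_def r_def)
qed

end

section \<open>Independence across orthogonal subsets\<close>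

context antichain_system
begin

lemma weyl_in_W: "A \<subseteq> \<Psi> \<Longrightarrow> v \<in> weyl_group d A \<Longrightarrow> v \<in> W"
  using weyl_subset[of A d \<Delta>] simple.reflect_pos_in_weyl antichain_pos by blast

lemmas finite_W = finite_weyl[OF simple.base_roots]
lemmas W_nonempty = weyl_nonempty[OF simple.base_roots]
lemmas W_isometry = weyl_isometry[OF simple.base_roots]
lemmas W_root = weyl_root[OF simple.base_roots]

definition negs :: "(nat \<Rightarrow> real) set \<Rightarrow> ((nat \<Rightarrow> real) \<Rightarrow> (nat \<Rightarrow> real)) \<Rightarrow> (nat \<Rightarrow> real) set" where
  "negs A w = {a \<in> A. ip d \<rho> (w a) < 0}"

text \<open>On every coset \<open>w W\<^sub>A\<close> the sign pattern of \<open>A\<close> has the distribution that it has for \<open>W\<^sub>A\<close>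
  itself: some \<open>w u\<close> in the coset makes all positive roots of \<open>A\<close> negative.\<close>
lemma coset_sum:
  assumes A: "A \<subseteq> \<Psi>" and w: "w \<in> W"
  shows "(\<Sum>v\<in>weyl_group d A. F (negs A (w \<circ> v)))
    = (\<Sum>v\<in>weyl_group d A. F {a \<in> A. v a \<in> positive_roots \<Phi> A})"
proof -
  interpret A: simple_base d \<Phi> A by (rule simple_base_subset[OF A])
  note iw = W_isometry[OF w]
  have "linear_functional (\<lambda>v. ip d \<rho> (w v))"
    by (rule linear_functional_comp[OF linear_functional_ip iw])
  moreover have "ip d \<rho> (w g) \<noteq> 0" if "g \<in> \<Phi>" for g using ip_rho_nz W_root w that by blast
  ultimately obtain u where u: "u \<in> weyl_group d A"
    and neg: "\<And>g. g \<in> positive_roots \<Phi> A \<Longrightarrow> ip d \<rho> (w (u g)) < 0"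
    using A.weyl_make_negative[of "\<lambda>v. ip d \<rho> (w v)"] by metis
  have iu: "isometry d u" using weyl_isometry A.base_roots u by blast
  have "(\<Sum>v\<in>weyl_group d A. F (negs A (w \<circ> v))) = (\<Sum>v\<in>weyl_group d A. F (negs A (w \<circ> (u \<circ> v))))"
    by (rule sum_weyl_left[OF A.base_roots u, symmetric])
  also have "\<dots> = (\<Sum>v\<in>weyl_group d A. F {a \<in> A. v a \<in> positive_roots \<Phi> A})"
  proof (rule sum.cong[OF refl])
    fix v assume v: "v \<in> weyl_group d A"
    have "ip d \<rho> (w (u (v a))) < 0 \<longleftrightarrow> v a \<in> positive_roots \<Phi> A" if a: "a \<in> A" for a
    proof (cases "v a \<in> positive_roots \<Phi> A")
      \<comment> \<open>Here the negative of \<open>v a\<close> is positive for \<open>A\<close>, so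
        it is made negative and \<open>v a\<close> itself positive.\<close>
      case False
      then have "(\<lambda>i. - v a i) \<in> positive_roots \<Phi> A" using A.weyl_pos_or_neg v a by blast
      then have "ip d \<rho> (w (u (\<lambda>i. - v a i))) < 0" by (rule neg)
      then show ?thesis using False by (simp add: isometry_minus[OF iu] isometry_minus[OF iw] ip_minus_right)
    qed (use neg in auto)
    then have "negs A (w \<circ> (u \<circ> v)) = {a \<in> A. v a \<in> positive_roots \<Phi> A}" by (auto simp: negs_def)
    then show "F (negs A (w \<circ> (u \<circ> v))) = F {a \<in> A. v a \<in> positive_roots \<Phi> A}" by simp
  qed
  finally show ?thesis .
qed

text \<open>Right translation by the group of \<open>A\<close> fixes \<open>C\<close>: on each coset
  the pattern of \<open>C\<close> is constant, while that of \<open>A\<close> sums to a value that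
  by \<open>coset_sum\<close> is the same for all cosets.\<close>

lemma sum_orthogonal:
  fixes F H :: "_ \<Rightarrow> real"
  assumes A: "A \<subseteq> \<Psi>" and C: "C \<subseteq> \<Psi>" and orth: "\<And>a c. a \<in> A \<Longrightarrow> c \<in> C \<Longrightarrow> ip d c a = 0"
  shows "real (card (weyl_group d A)) * (\<Sum>w\<in>W. F (negs A w) * H (negs C w))
    = (\<Sum>v\<in>weyl_group d A. F {a \<in> A. v a \<in> positive_roots \<Phi> A}) * (\<Sum>w\<in>W. H (negs C w))"
proof -
  have eq: "(\<Sum>w\<in>W. F (negs A w) * H (negs C w)) = (\<Sum>w\<in>W. F (negs A (w \<circ> v)) * H (negs C w))"
    if v: "v \<in> weyl_group d A" for v
  proof -
    have "v c = c" if "c \<in> C" for c using weyl_fixes[OF v] orth that by blast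
    then have "negs C (w \<circ> v) = negs C w" for w by (auto simp: negs_def)
    then show ?thesis
      using sum_weyl_right[OF simple.base_roots weyl_in_W[OF A v], of "\<lambda>w. F (negs A w) * H (negs C w)"] by simp
  qed
  have "(\<Sum>v\<in>weyl_group d A. \<Sum>w\<in>W. F (negs A w) * H (negs C w))
      = (\<Sum>v\<in>weyl_group d A. \<Sum>w\<in>W. F (negs A (w \<circ> v)) * H (negs C w))"
    by (intro sum.cong refl eq)
  also have "\<dots> = (\<Sum>w\<in>W. (\<Sum>v\<in>weyl_group d A. F (negs A (w \<circ> v))) * H (negs C w))"
    by (subst sum.swap) (simp add: sum_distrib_right)
  also have "\<dots> = (\<Sum>w\<in>W. (\<Sum>v\<in>weyl_group d A. F {a \<in> A. v a \<in> positive_roots \<Phi> A}) * H (negs C w))"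
    by (intro sum.cong refl) (simp only: coset_sum[OF A, of _ F])
  finally show ?thesis by (simp add: sum_distrib_left)
qed

lemma card_pos: "A \<subseteq> \<Psi> \<Longrightarrow> 0 < card (weyl_group d A)" "0 < card W"
  using finite_weyl[of A] weyl_nonempty[of A] antichain_roots finite_W W_nonempty
  by (auto simp: card_gt_0_iff)

lemma orthogonal_independent:
  fixes F H :: "_ \<Rightarrow> real"
  assumes A: "A \<subseteq> \<Psi>" and C: "C \<subseteq> \<Psi>" and orth: "\<And>a c. a \<in> A \<Longrightarrow> c \<in> C \<Longrightarrow> ip d c a = 0"
  shows "avg W (\<lambda>w. F (negs A w) * H (negs C w)) = avg W (\<lambda>w. F (negs A w)) * avg W (\<lambda>w. H (negs C w))"
proof -
  define n where "n = real (card (weyl_group d A))"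
  define N where "N = real (card W)"
  define S where "S = (\<Sum>v\<in>weyl_group d A. F {a \<in> A. v a \<in> positive_roots \<Phi> A})"
  have pos: "n \<noteq> 0" "N \<noteq> 0" using card_pos A by (simp_all add: n_def N_def)
  have 1: "n * (\<Sum>w\<in>W. F (negs A w) * H (negs C w)) = S * (\<Sum>w\<in>W. H (negs C w))"
    using sum_orthogonal[OF A C orth] by (simp add: n_def S_def)
  \<comment> \<open>With \<open>C\<close> empty and \<open>H\<close> constant this describes F
    alone; \<open>S\<close> is then eliminated between the two equations.\<close>
  have 2: "n * (\<Sum>w\<in>W. F (negs A w)) = S * N"
    using sum_orthogonal[OF A, of "{}" F "\<lambda>_. 1"] by (simp add: n_def S_def N_def)
  have 3: "(\<Sum>w\<in>W. F (negs A w) * H (negs C w)) = S * (\<Sum>w\<in>W. H (negs C w)) / n" using 1 pos by (simp add: field_simps)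
  have 4: "(\<Sum>w\<in>W. F (negs A w)) = S * N / n" using 2 pos by (simp add: field_simps)
  show ?thesis unfolding avg_def 3 4 N_def[symmetric] using pos by simp
qed

text \<open>The identity in the group of \<open>A\<close> leaves all of \<open>A\<close> positive
  and contributes 1 to the coset sum.\<close>

lemma prob_all_negative_ge:
  assumes A: "A \<subseteq> \<Psi>"
  shows "1 / real (card (weyl_group d A)) \<le> avg W (\<lambda>w. of_bool (negs A w = A))"
proof -
  define S where "S = (\<Sum>v\<in>weyl_group d A. of_bool ({a \<in> A. v a \<in> positive_roots \<Phi> A} = A) :: real)"
  interpret A: simple_base d \<Phi> A by (rule simple_base_subset[OF A])
  have "real (card (weyl_group d A)) * (\<Sum>w\<in>W. of_bool (negs A w = A)) = S * real (card W)"
    using sum_orthogonal[OF A, of "{}" "\<lambda>T. of_bool (T = A)" "\<lambda>_. 1"] by (simp add: S_def)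
  then have eq: "avg W (\<lambda>w. of_bool (negs A w = A)) = S / real (card (weyl_group d A))"
    using card_pos A by (simp add: avg_def field_simps)
  have "{a \<in> A. id a \<in> positive_roots \<Phi> A} = A" using A.base_pos by auto
  then have "1 \<le> S" unfolding S_def
    using member_le_sum[of id "weyl_group d A" "\<lambda>v. of_bool ({a \<in> A. v a \<in> positive_roots \<Phi> A} = A) :: real"]
      finite_weyl[OF A.base_roots] weyl_group.id_in by simp
  then show ?thesis unfolding eq by (intro divide_right_mono) auto
qed

section \<open>Covariances, variance and degrees\<close>

definition dev :: "(nat \<Rightarrow> real) \<Rightarrow> ((nat \<Rightarrow> real) \<Rightarrow> (nat \<Rightarrow> real)) \<Rightarrow> real" where
  "dev a w = of_bool (ip d \<rho> (w a) < 0) - 1 / 2"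

lemma dev_abs: "\<bar>dev a w\<bar> = 1 / 2"
  by (simp add: dev_def)

lemma dev_square: "dev a w * dev a w = 1 / 4"
  by (simp add: dev_def)

text \<open>Right multiplication by the reflection in a permutes \<open>W\<close> and flips the sign
  of w a.\<close>

lemma avg_dev:
  assumes a: "a \<in> \<Psi>" shows "avg W (dev a) = 0"
proof -
  have aP: "a \<in> \<Phi>" using a antichain_roots by blast
  have s: "reflect_root d a \<in> W" using simple.reflect_pos_in_weyl a antichain_pos by blast
  have "(\<Sum>w\<in>W. dev a w) = (\<Sum>w\<in>W. dev a (w \<circ> reflect_root d a))"
    using sum_weyl_right[OF simple.base_roots s, of "dev a"] by simp
  also have "\<dots> = (\<Sum>w\<in>W. - dev a w)"
  proof (rule sum.cong[OF refl])
    fix w assume w: "w \<in> W"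
    show "dev a (w \<circ> reflect_root d a) = - dev a w"
      using ip_rho_nz[OF W_root[OF w aP]]
      by (auto simp: dev_def reflect_self[OF root_ip_nz[OF aP]] isometry_minus[OF W_isometry[OF w]] ip_minus_right)
  qed
  finally show ?thesis by (simp add: avg_def sum_negf)
qed

definition unit :: "(nat \<Rightarrow> real) \<Rightarrow> (nat \<Rightarrow> real)" where
  "unit a = (\<lambda>i. (1 / sqrt (ip d a a)) * a i)"

lemma ip_unit: "ip d (unit a) (unit b) = ip d a b / (sqrt (ip d a a) * sqrt (ip d b b))"
  unfolding unit_def by (simp only: ip_scale_left ip_scale_right) simp

lemma ip_unit_self: "a \<in> \<Psi> \<Longrightarrow> ip d (unit a) (unit a) = 1"
  using root_ip_pos[of a] antichain_roots by (auto simp: ip_unit)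

lemma ip_unit_nonpos: "a \<in> \<Psi> \<Longrightarrow> b \<in> \<Psi> \<Longrightarrow> a \<noteq> b \<Longrightarrow> ip d (unit a) (unit b) \<le> 0"
  using antichain_obtuse[of a b] by (simp add: ip_unit divide_nonpos_nonneg ip_self_nonneg)

text \<open>Strict Cauchy-Schwarz keeps the product of the two Cartan integers below 4; they are
  nonpositive by obtuseness and vanish together. x * y is four times the squared cosine, and
  \<open>m\<close> is the exponent for \<open>rotation_order\<close>.\<close>

lemma pair_classification:
  assumes ab: "a \<in> \<Psi>" "b \<in> \<Psi>" "a \<noteq> b"
  obtains x y :: real and m :: nat where "cartan d b a = - x" "cartan d a b = - y"
    "(x, y, m) \<in> {(0, 0, 2), (1, 1, 3), (1, 2, 4), (2, 1, 4), (1, 3, 6), (3, 1, 6)}"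
    "ip d (unit a) (unit b) = - sqrt (x * y) / 2"
proof -
  have r: "a \<in> \<Phi>" "b \<in> \<Phi>" using ab antichain_roots by auto
  have p: "0 < ip d a a" "0 < ip d b b" using r root_ip_pos by auto
  have o: "ip d a b \<le> 0" using antichain_obtuse ab by blast
  obtain k l where k: "cartan d b a = of_int k" and l: "cartan d a b = of_int l"
    using cartan_int r by (metis Ints_cases)
  have kd: "of_int k = 2 * ip d a b / ip d a a" and ld: "of_int l = 2 * ip d a b / ip d b b"
    using k l by (simp_all add: cartan_def ip_commute[of d b a])
  have "real_of_int k \<le> 0" "real_of_int l \<le> 0" unfolding kd ld using p o by (auto simp: divide_nonpos_pos)
  then have kl0: "k \<le> 0" "l \<le> 0" by auto
  have kl: "real_of_int k * real_of_int l = 4 * (ip d a b)\<^sup>2 / (ip d a a * ip d b b)"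
    unfolding kd ld by (simp add: power2_eq_square)
  have strict: "(ip d a b)\<^sup>2 < ip d a a * ip d b b"
  proof (rule ccontr)
    assume n: "\<not> ?thesis"
    \<comment> \<open>In the equality case of Cauchy-Schwarz this vector vanishes, so a is a
      multiple of b, hence b or its negative.\<close>
    define v where "v = (\<lambda>i. ip d b b * a i - ip d a b * b i)"
    have "ip d v v = ip d b b * (ip d a a * ip d b b - (ip d a b)\<^sup>2)"
      by (simp only: v_def ip_linear) (simp add: ip_commute[of d b a] power2_eq_square algebra_simps)
    also have "\<dots> \<le> 0" using n p by (simp add: mult_nonneg_nonpos)
    finally have "ip d v v \<le> 0" .
    moreover have "v \<in> evec d" using subsetD[OF root_evec r(1)] subsetD[OF root_evec r(2)] by (simp add: v_def evec_def)
    ultimately have "v = (\<lambda>i. 0)" using ip_self_eq_0 by blast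
    then have "v i = 0" for i by simp
    then have "ip d b b * a i = ip d a b * b i" for i by (simp add: v_def)
    then have "a i = (ip d a b / ip d b b) * b i" for i using p by (simp add: field_simps)
    then have eq: "a = (\<lambda>i. (ip d a b / ip d b b) * b i)" by blast
    then have "ip d a b / ip d b b = 1 \<or> ip d a b / ip d b b = -1"
      using root_multiple[of b "ip d a b / ip d b b"] r by simp
    then have "a = b \<or> a = (\<lambda>i. - b i)" using eq by (metis (no_types, lifting) ext mult_1 mult_minus1)
    then show False using ab antichain_pos simple.uminus_notin_pos by blast
  qed
  have "real_of_int k * real_of_int l < 4" unfolding kl using strict p by (simp add: field_simps)
  then have kl4: "k * l < 4" by (metis of_int_less_iff of_int_mult of_int_numeral)
  have zero: "k = 0 \<longleftrightarrow> l = 0"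
  proof -
    have "real_of_int k = 0 \<longleftrightarrow> real_of_int l = 0" unfolding kd ld using p by simp
    then show ?thesis by simp
  qed
  define x y where "x = - real_of_int k" and "y = - real_of_int l"
  have u: "ip d (unit a) (unit b) = - sqrt (x * y) / 2"
  proof -
    have "x * y = (2 * ip d a b / (sqrt (ip d a a) * sqrt (ip d b b)))\<^sup>2"
      using kl p by (simp add: x_def y_def power_divide power_mult_distrib)
    then have "sqrt (x * y) = \<bar>2 * ip d a b / (sqrt (ip d a a) * sqrt (ip d b b))\<bar>" by simp
    also have "\<dots> = - (2 * ip d a b / (sqrt (ip d a a) * sqrt (ip d b b)))"
      using o p by (intro abs_of_nonpos) (simp add: divide_nonpos_nonneg)
    finally show ?thesis by (simp add: ip_unit)
  qed
  have "\<exists>m. (x, y, m) \<in> {(0, 0, 2), (1, 1, 3), (1, 2, 4), (2, 1, 4), (1, 3, 6), (3, 1, 6::nat)}"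
  proof (cases "k = 0")
    case False
    define i j where "i = - k" and "j = - l"
    have ij: "1 \<le> i" "1 \<le> j" "i * j < 4" using kl0 kl4 False zero by (auto simp: i_def j_def)
    have "i * 1 \<le> i * j" "1 * j \<le> i * j" using ij by (intro mult_left_mono mult_right_mono; simp)+
    then have "i \<le> 3" "j \<le> 3" using ij(3) by linarith+
    then have "i = 1 \<or> i = 2 \<or> i = 3" "j = 1 \<or> j = 2 \<or> j = 3" using ij(1,2) by linarith+
    then have "(i, j) \<in> {(1, 1), (1, 2), (2, 1), (1, 3), (3, 1)}" using ij(3) by auto
    moreover have "x = of_int i" "y = of_int j" by (simp_all add: x_def y_def i_def j_def)
    ultimately show ?thesis by auto
  qed (use zero in \<open>auto simp: x_def y_def\<close>)
  then obtain m :: nat where "(x, y, m) \<in> {(0, 0, 2), (1, 1, 3), (1, 2, 4), (2, 1, 4), (1, 3, 6), (3, 1, 6)}" ..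
  moreover have "cartan d b a = - x" "cartan d a b = - y" by (simp_all add: x_def y_def k l)
  ultimately show ?thesis using that u by blast
qed

text \<open>The covariance bounds 0, -1/12, -1/8, -1/6 for m = 2, 3, 4, 6 face the inner products 0,
  -1/2, -sqrt 2 / 2, -sqrt 3 / 2. The factor 1/5 exceeds the largest ratio 1 / (3 sqrt 3) and stays
  below the diagonal value 1/4, of which 1/20 is left.\<close>

lemma avg_dev_mult_ge:
  assumes ab: "a \<in> \<Psi>" "b \<in> \<Psi>"
  shows "of_bool (a = b) / 20 + ip d (unit a) (unit b) / 5 \<le> avg W (\<lambda>w. dev a w * dev b w)"
proof (cases "a = b")
  case True
  then show ?thesis using ab by (simp add: dev_square avg_const finite_W W_nonempty ip_unit_self)
next
  case False
  obtain x y :: real and m :: nat where xy: "cartan d b a = - x" "cartan d a b = - y"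
    "(x, y, m) \<in> {(0, 0, 2), (1, 1, 3), (1, 2, 4), (2, 1, 4), (1, 3, 6), (3, 1, 6)}"
    and u: "ip d (unit a) (unit b) = - sqrt (x * y) / 2"
    using pair_classification[OF ab False] by metis
  have r: "a \<in> \<Phi>" "b \<in> \<Phi>" using ab antichain_roots by auto
  have m0: "0 < m" using xy(3) by auto
  have "card (weyl_group d {a, b}) \<le> 2 * m"
    by (rule card_weyl_pair_le[OF r m0 rotation_order[OF r xy]])
  then have "1 / (2 * real m) \<le> 1 / real (card (weyl_group d {a, b}))"
    using card_pos(1)[of "{a, b}"] ab by (intro divide_left_mono) auto
  also have "\<dots> \<le> avg W (\<lambda>w. of_bool (negs {a, b} w = {a, b}))"
    using prob_all_negative_ge[of "{a, b}"] ab by simp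
  \<comment> \<open>The indicator that both roots turn negative is (dev a + 1/2) (dev b +
    1/2).\<close>
  also have "\<dots> = avg W (\<lambda>w. dev a w * dev b w + 1/2 * dev a w + 1/2 * dev b w + 1/4)"
    by (intro avg_cong) (auto simp: dev_def negs_def)
  also have "\<dots> = avg W (\<lambda>w. dev a w * dev b w) + 1/4"
    unfolding avg_add avg_cmult avg_const[OF finite_W W_nonempty] using avg_dev ab by simp
  finally have 1: "1 / (2 * real m) - 1/4 \<le> avg W (\<lambda>w. dev a w * dev b w)" by simp
  \<comment> \<open>Exactly the bounds required by m = 4 and, below, by m = 6.\<close>
  have "5/4 \<le> sqrt 2" by (rule real_le_rsqrt) (simp add: power2_eq_square)
  moreover have "5/3 \<le> sqrt 3" by (rule real_le_rsqrt) (simp add: power2_eq_square)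
  ultimately have "- sqrt (x * y) / 10 \<le> 1 / (2 * real m) - 1/4" using xy(3) by auto
  then show ?thesis using 1 False by (simp add: u)
qed

lemma variance_ge: "real (card \<Psi>) / 20 \<le> avg W (\<lambda>w. (\<Sum>a\<in>\<Psi>. dev a w)\<^sup>2)"
proof -
  define s where "s = (\<lambda>i. \<Sum>a\<in>\<Psi>. unit a i)"
  have "ip d s s = (\<Sum>a\<in>\<Psi>. \<Sum>b\<in>\<Psi>. ip d (unit a) (unit b))"
    unfolding s_def by (simp add: ip_sum_left ip_commute[of d _ "\<lambda>i. \<Sum>a\<in>\<Psi>. unit a i"])
      (simp add: ip_commute)
  then have s: "0 \<le> (\<Sum>a\<in>\<Psi>. \<Sum>b\<in>\<Psi>. ip d (unit a) (unit b))" using ip_self_nonneg[of d s] by simp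
  have "real (card \<Psi>) / 20 + (\<Sum>a\<in>\<Psi>. \<Sum>b\<in>\<Psi>. ip d (unit a) (unit b)) / 5
    = (\<Sum>a\<in>\<Psi>. \<Sum>b\<in>\<Psi>. of_bool (a = b) / 20 + ip d (unit a) (unit b) / 5)"
    by (simp add: sum.distrib finite_antichain of_bool_def if_distrib[of "\<lambda>x. x / 20"] flip: sum_divide_distrib cong: if_cong)
  also have "\<dots> \<le> (\<Sum>a\<in>\<Psi>. \<Sum>b\<in>\<Psi>. avg W (\<lambda>w. dev a w * dev b w))"
    by (intro sum_mono avg_dev_mult_ge)
  also have "\<dots> = avg W (\<lambda>w. (\<Sum>a\<in>\<Psi>. dev a w)\<^sup>2)"
    by (simp add: power2_eq_square sum_product avg_sum)
  finally show ?thesis using s by linarith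
qed

text \<open>The count includes a itself. With n neighbours, of pairwise nonpositive products, the
  squared length of \<open>v\<close> is at most 1 - n/2 + n/4; the weight 1/2 minimizes this
  estimate.\<close>

lemma degree_le:
  assumes a: "a \<in> \<Psi>" shows "card {b \<in> \<Psi>. ip d a b \<noteq> 0} \<le> 5"
proof -
  define S where "S = {b \<in> \<Psi>. b \<noteq> a \<and> ip d a b \<noteq> 0}"
  have S: "S \<subseteq> \<Psi>" "finite S" using finite_antichain by (auto simp: S_def)
  define s where "s = (\<lambda>i. \<Sum>b\<in>S. unit b i)"
  define v where "v = (\<lambda>i. unit a i + 1/2 * s i)"
  have le: "ip d (unit b) (unit a) \<le> - 1/2" if b: "b \<in> S" for b
  proof -
    have b': "b \<in> \<Psi>" "b \<noteq> a" "ip d b a \<noteq> 0" using b by (auto simp: S_def ip_commute)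
    obtain x y m where xy: "(x, y, m) \<in> {(0, 0, 2), (1, 1, 3), (1, 2, 4), (2, 1, 4), (1, 3, 6), (3, 1, 6::nat)}"
      and u: "ip d (unit b) (unit a) = - sqrt (x * y) / 2"
      using pair_classification[OF b'(1) a b'(2)] by metis
    have "ip d (unit b) (unit a) \<noteq> 0"
      using b' a root_ip_pos antichain_roots by (force simp: ip_unit)
    then have "1 \<le> x * y" using xy u by auto
    then show ?thesis by (simp add: u)
  qed
  have "ip d s s = (\<Sum>b\<in>S. \<Sum>c\<in>S. ip d (unit c) (unit b))"
    unfolding s_def by (simp add: ip_sum_left ip_commute[of d _ "\<lambda>i. \<Sum>a\<in>S. unit a i"])
  also have "\<dots> \<le> (\<Sum>b\<in>S. \<Sum>c\<in>S. of_bool (b = c))"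
    using ip_unit_self ip_unit_nonpos S by (intro sum_mono) (auto simp: of_bool_def)
  also have "\<dots> = real (card S)" using S by (simp add: of_bool_def cong: if_cong)
  finally have ss: "ip d s s \<le> real (card S)" .
  have sa: "ip d s (unit a) \<le> - real (card S) / 2"
    using sum_mono[of S "\<lambda>b. ip d (unit b) (unit a)" "\<lambda>b. - 1/2"] le by (simp add: s_def ip_sum_left)
  have "0 \<le> ip d v v" by (rule ip_self_nonneg)
  also have "ip d v v = 1 + ip d s (unit a) + ip d s s / 4"
    by (simp only: v_def ip_linear) (simp add: ip_unit_self[OF a] ip_commute[of d "unit a" s] field_simps)
  finally have "real (card S) \<le> 4" using ss sa by linarith
  moreover have "{b \<in> \<Psi>. ip d a b \<noteq> 0} \<subseteq> insert a S" by (auto simp: S_def)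
  then have "card {b \<in> \<Psi>. ip d a b \<noteq> 0} \<le> card (insert a S)" using S by (intro card_mono) auto
  ultimately show ?thesis using card_insert_le_m1[of 5 S a] by simp
qed

text \<open>5 is the size of a closed neighbourhood and 20 the reciprocal of the variance constant;
  sqrt 20 converts 1/\<sigma> into the reciprocal root of the cardinality.\<close>

lemma antichain_berry_esseen:
  assumes ne: "\<Psi> \<noteq> {}"
  defines "\<sigma> \<equiv> sqrt (avg W (\<lambda>w. (\<Sum>a\<in>\<Psi>. dev a w)\<^sup>2))"
  shows "\<bar>avg W (\<lambda>w. of_bool ((\<Sum>a\<in>\<Psi>. dev a w) / \<sigma> \<le> z)) - ncdf z\<bar>
    \<le> local_dependence.c3 5 20 * sqrt 20 / sqrt (real (card \<Psi>))"
proof -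
  define N where "N = real (card \<Psi>)"
  have N: "0 < N" using ne finite_antichain by (simp add: N_def card_gt_0_iff)
  have var: "N / 20 \<le> avg W (\<lambda>w. (\<Sum>a\<in>\<Psi>. dev a w)\<^sup>2)" using variance_ge by (simp add: N_def)
  have \<sigma>2: "\<sigma>\<^sup>2 = avg W (\<lambda>w. (\<Sum>a\<in>\<Psi>. dev a w)\<^sup>2)" using var N by (simp add: \<sigma>_def)
  have \<sigma>: "0 < \<sigma>" using var N by (simp add: \<sigma>_def)
  define \<xi> where "\<xi> = (\<lambda>a w. dev a w / \<sigma>)"
  define A where "A = (\<lambda>a. {b \<in> \<Psi>. ip d a b \<noteq> 0})"
  \<comment> \<open>Reads a summand off the sign pattern of any set containing a, the form required
    by \<open>orthogonal_independent\<close>.\<close>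
  define F :: "(nat \<Rightarrow> real) \<Rightarrow> (nat \<Rightarrow> real) set \<Rightarrow> real" where "F = (\<lambda>a T. (of_bool (a \<in> T) - 1/2) / \<sigma>)"
  have \<xi>F: "\<xi> a w = F a (negs T w)" if "a \<in> T" for a T w
    using that by (simp add: \<xi>_def F_def dev_def negs_def)
  interpret ld: local_dependence W \<Psi> \<xi> A 5 20 "1 / \<sigma>"
  proof
    show "finite W" "W \<noteq> {}" "finite \<Psi>" by (rule finite_W W_nonempty finite_antichain)+
    show "A i \<subseteq> \<Psi>" for i by (auto simp: A_def)
    show "i \<in> A j" if "i \<in> \<Psi>" "j \<in> A i" for i j using that by (simp add: A_def ip_commute)
    show "card (A i) \<le> 5" if "i \<in> \<Psi>" for i using degree_le[OF that] by (simp add: A_def)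
    show "\<bar>\<xi> i w\<bar> \<le> 1 / \<sigma>" for i w using \<sigma> by (simp add: \<xi>_def dev_abs field_simps)
    show "avg W (\<lambda>w. \<xi> i w * f (\<Sum>j\<in>\<Psi> - A i. \<xi> j w)) = 0" if i: "i \<in> \<Psi>" for i f
    proof -
      define H where "H = (\<lambda>T. f (\<Sum>j\<in>\<Psi> - A i. F j T))"
      have e: "\<xi> i w * f (\<Sum>j\<in>\<Psi> - A i. \<xi> j w) = F i (negs {i} w) * H (negs (\<Psi> - A i) w)" for w
        by (simp add: H_def \<xi>F[of i "{i}"] \<xi>F[of _ "\<Psi> - A i"])
      have "avg W (\<lambda>w. F i (negs {i} w)) = avg W (\<lambda>w. 1 / \<sigma> * dev i w)"
        by (intro avg_cong) (simp add: \<xi>F[symmetric] \<xi>_def)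
      then have z: "avg W (\<lambda>w. F i (negs {i} w)) = 0" unfolding avg_cmult using avg_dev[OF i] by simp
      show ?thesis unfolding e
        by (subst orthogonal_independent) (use i z in \<open>auto simp: A_def ip_commute\<close>)
    qed
    show "avg W (\<lambda>w. (\<xi> i w * \<xi> j w) * (\<xi> k w * \<xi> l w))
        = avg W (\<lambda>w. \<xi> i w * \<xi> j w) * avg W (\<lambda>w. \<xi> k w * \<xi> l w)"
      if h: "i \<in> \<Psi>" "j \<in> A i" "k \<in> \<Psi>" "l \<in> A k" "{k, l} \<inter> (A i \<union> A j) = {}" for i j k l
    proof -
      have p: "\<xi> i w * \<xi> j w = F i (negs {i, j} w) * F j (negs {i, j} w)" for i j w
        by (simp add: \<xi>F[of i "{i, j}"] \<xi>F[of j "{i, j}"])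
      have jl: "j \<in> \<Psi>" "l \<in> \<Psi>" using h by (auto simp: A_def)
      then have "ip d c a = 0" if "a \<in> {i, j}" "c \<in> {k, l}" for a c
        using h that by (auto simp: A_def ip_commute)
      then show ?thesis unfolding p
        using orthogonal_independent[of "{i, j}" "{k, l}" "\<lambda>T. F i T * F j T" "\<lambda>T. F k T * F l T"] h jl by blast
    qed
    show "avg W (\<lambda>w. (\<Sum>i\<in>\<Psi>. \<xi> i w)\<^sup>2) = 1"
    proof -
      have "avg W (\<lambda>w. (\<Sum>i\<in>\<Psi>. \<xi> i w)\<^sup>2) = avg W (\<lambda>w. 1 / \<sigma>\<^sup>2 * (\<Sum>i\<in>\<Psi>. dev i w)\<^sup>2)"
        by (simp add: \<xi>_def power_divide flip: sum_divide_distrib)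
      also have "\<dots> = 1" unfolding avg_cmult using \<sigma> by (simp flip: \<sigma>2)
      finally show ?thesis .
    qed
    show "real (card \<Psi>) * (1 / \<sigma>)\<^sup>2 \<le> 20"
      using var \<sigma> unfolding \<sigma>2[symmetric] N_def by (simp add: field_simps)
  qed (use \<sigma> in auto)
  have "(\<Sum>a\<in>\<Psi>. dev a w) / \<sigma> = ld.W w" for w
    unfolding ld.W_def by (simp add: \<xi>_def sum_divide_distrib)
  then have "\<bar>avg W (\<lambda>w. of_bool ((\<Sum>a\<in>\<Psi>. dev a w) / \<sigma> \<le> z)) - ncdf z\<bar> \<le> ld.c3 * (1 / \<sigma>)"
    using ld.berry_esseen[of z] by simp
  also have "\<dots> \<le> ld.c3 * (sqrt 20 / sqrt N)"
  proof (rule mult_left_mono)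
    have "sqrt (N / 20) \<le> \<sigma>" unfolding \<sigma>_def using var by (rule real_sqrt_le_mono)
    then show "1 / \<sigma> \<le> sqrt 20 / sqrt N" using \<sigma> N by (simp add: real_sqrt_divide field_simps)
    show "0 \<le> ld.c3" using ld.\<kappa>(1) by (simp add: ld.c3_def ld.c2_def ld.c1_def)
  qed
  finally show ?thesis by (simp add: N_def)
qed

section \<open>Standardization and the limit theorem\<close>

lemma X_var_eq: "w \<in> W \<Longrightarrow> X_var \<Phi> \<Delta> \<Psi> w = (\<Sum>a\<in>\<Psi>. dev a w) + real (card \<Psi>) / 2"
proof -
  assume w: "w \<in> W"
  have "{b \<in> \<Psi>. w b \<in> neg_vec ` positive_roots \<Phi> \<Delta>} = {b \<in> \<Psi>. ip d \<rho> (w b) < 0}"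
    using neg_iff W_root[OF w] antichain_roots by blast
  then have "X_var \<Phi> \<Delta> \<Psi> w = (\<Sum>a\<in>\<Psi>. of_bool (ip d \<rho> (w a) < 0))"
    using finite_antichain by (simp add: X_var_def Int_def)
  then show ?thesis by (simp add: dev_def sum_subtractf)
qed

lemma standardized_X_var:
  assumes w: "w \<in> W"
  defines "E \<equiv> measure_pmf.expectation (pmf_of_set W)"
  shows "(X_var \<Phi> \<Delta> \<Psi> w - E (X_var \<Phi> \<Delta> \<Psi>)) / sqrt (measure_pmf.variance (pmf_of_set W) (X_var \<Phi> \<Delta> \<Psi>))
    = (\<Sum>a\<in>\<Psi>. dev a w) / sqrt (avg W (\<lambda>w. (\<Sum>a\<in>\<Psi>. dev a w)\<^sup>2))"
proof -
  have E: "E f = avg W f" for f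
    by (simp add: E_def avg_def integral_pmf_of_set finite_W W_nonempty)
  have "avg W (X_var \<Phi> \<Delta> \<Psi>) = avg W (\<lambda>w. (\<Sum>a\<in>\<Psi>. dev a w) + real (card \<Psi>) / 2)"
    by (intro avg_cong X_var_eq)
  also have "\<dots> = real (card \<Psi>) / 2"
    unfolding avg_add avg_sum avg_const[OF finite_W W_nonempty] using avg_dev by simp
  finally have m: "avg W (X_var \<Phi> \<Delta> \<Psi>) = real (card \<Psi>) / 2" .
  have "measure_pmf.variance (pmf_of_set W) (X_var \<Phi> \<Delta> \<Psi>) = avg W (\<lambda>w. (X_var \<Phi> \<Delta> \<Psi> w - avg W (X_var \<Phi> \<Delta> \<Psi>))\<^sup>2)"
    by (simp only: E[unfolded E_def])
  also have "\<dots> = avg W (\<lambda>w. (\<Sum>a\<in>\<Psi>. dev a w)\<^sup>2)"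
    by (intro avg_cong) (simp add: X_var_eq m)
  finally show ?thesis using m w by (simp add: X_var_eq E)
qed

lemma prob_standardized_X_var:
  assumes "\<Psi> \<noteq> {}"
  defines "Z \<equiv> \<lambda>w. (X_var \<Phi> \<Delta> \<Psi> w - measure_pmf.expectation (pmf_of_set W) (X_var \<Phi> \<Delta> \<Psi>))
    / sqrt (measure_pmf.variance (pmf_of_set W) (X_var \<Phi> \<Delta> \<Psi>))"
  shows "\<bar>measure_pmf.prob (pmf_of_set W) {w. Z w \<le> z} - ncdf z\<bar>
    \<le> local_dependence.c3 5 20 * sqrt 20 / sqrt (real (card \<Psi>))"
proof -
  have "measure_pmf.prob (pmf_of_set W) {w. Z w \<le> z} = avg W (\<lambda>w. of_bool (Z w \<le> z))"
    using finite_W W_nonempty by (simp add: measure_pmf_of_set avg_def)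
  also have "\<dots> = avg W (\<lambda>w. of_bool ((\<Sum>a\<in>\<Psi>. dev a w) / sqrt (avg W (\<lambda>w. (\<Sum>a\<in>\<Psi>. dev a w)\<^sup>2)) \<le> z))"
    unfolding Z_def by (intro avg_cong) (simp only: standardized_X_var)
  finally show ?thesis using antichain_berry_esseen[OF assms(1)] by simp
qed

end

theorem theorem2p6:
  fixes d :: "nat \<Rightarrow> nat"
    and \<Phi> \<Delta> \<Psi> :: "nat \<Rightarrow> (nat \<Rightarrow> real) set"
  assumes rs: "\<And>n. crystallographic_root_system (d n) (\<Phi> n)"
    and ss: "\<And>n. simple_system (d n) (\<Phi> n) (\<Delta> n)"
    and ac: "\<And>n. root_antichain (\<Phi> n) (\<Delta> n) (\<Psi> n)"
    and lim: "filterlim (\<lambda>n. card (\<Psi> n)) at_top sequentially"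
  defines "Y \<equiv> \<lambda>n w. (X_var (\<Phi> n) (\<Delta> n) (\<Psi> n) w
                     - measure_pmf.expectation (pmf_of_set (weyl_group (d n) (\<Delta> n))) (X_var (\<Phi> n) (\<Delta> n) (\<Psi> n)))
                   / sqrt (measure_pmf.variance (pmf_of_set (weyl_group (d n) (\<Delta> n))) (X_var (\<Phi> n) (\<Delta> n) (\<Psi> n)))"
  shows "weak_conv_m (\<lambda>n. distr (measure_pmf (pmf_of_set (weyl_group (d n) (\<Delta> n)))) borel (Y n)) std_normal_distribution
    \<and> (\<exists>C::real. \<forall>\<^sub>F n in sequentially. \<forall>x::real.
          \<bar>measure_pmf.prob (pmf_of_set (weyl_group (d n) (\<Delta> n))) {w. Y n w \<le> x} - measure std_normal_distribution {..x}\<bar>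
            \<le> C / sqrt (real (card (\<Psi> n))))"
proof -
  \<comment> \<open>The same for all n, since it involves only the degree bound and the variance
    constant.\<close>
  define C where "C = local_dependence.c3 5 20 * sqrt 20"
  define P where "P = (\<lambda>n x. measure_pmf.prob (pmf_of_set (weyl_group (d n) (\<Delta> n))) {w. Y n w \<le> x})"
  \<comment> \<open>Excludes empty antichains, whose variance is 0.\<close>
  have "\<forall>\<^sub>F n in sequentially. 1 \<le> card (\<Psi> n)" using lim by (simp add: filterlim_at_top)
  then have bound: "\<forall>\<^sub>F n in sequentially. \<forall>x. \<bar>P n x - ncdf x\<bar> \<le> C / sqrt (real (card (\<Psi> n)))"
  proof eventually_elim
    case (elim n)
    interpret antichain_system "d n" "\<Phi> n" "\<Delta> n" "\<Psi> n"
      by unfold_locales (rule rs ss ac)+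
    have "\<Psi> n \<noteq> {}" using elim by auto
    then show ?case using prob_standardized_X_var by (simp add: P_def Y_def C_def)
  qed
  have "filterlim (\<lambda>n. real (card (\<Psi> n))) at_top sequentially"
    by (rule filterlim_compose[OF filterlim_real_sequentially lim])
  then have "filterlim (\<lambda>n. sqrt (real (card (\<Psi> n)))) at_top sequentially"
    by (rule filterlim_compose[OF sqrt_at_top])
  then have to0: "(\<lambda>n. C / sqrt (real (card (\<Psi> n)))) \<longlonglongrightarrow> 0"
    by (rule real_tendsto_divide_at_top[OF tendsto_const])
  \<comment> \<open>The uniform bound tends to 0, so the distribution functions converge at every
    point, which yields weak convergence.\<close>
  have conv: "(\<lambda>n. P n x) \<longlonglongrightarrow> ncdf x" for x
  proof -
    have "(\<lambda>n. P n x - ncdf x) \<longlonglongrightarrow> 0"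
      by (rule Lim_null_comparison[OF _ to0]) (use bound in \<open>auto elim: eventually_mono\<close>)
    then show ?thesis by (simp add: LIM_zero_iff)
  qed
  have "cdf (distr (measure_pmf (pmf_of_set (weyl_group (d n) (\<Delta> n)))) borel (Y n)) x = P n x" for n x
    by (simp add: cdf_def measure_distr P_def vimage_def)
  then have "weak_conv_m (\<lambda>n. distr (measure_pmf (pmf_of_set (weyl_group (d n) (\<Delta> n)))) borel (Y n)) std_normal_distribution"
    using conv by (simp add: weak_conv_m_def weak_conv_def) (simp add: cdf_def)
  then show ?thesis using bound unfolding P_def by blast
qed

end
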